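(* Let $n,N$ be positive integers, $\lambda\in\mathcal{O}(n,N)$, $\Lambda\in\mathcal{L}(\lambda,n)$ and $k\in\{1,\dots,n\}$. Suppose that the diagrams $\Lambda(k-1)$ and $\Lambda(k)$ differ by the box occurring in row $i$ and column $j$. Then the eigenvalue $x_k(\Lambda)$ of $x_k$ on the canonical basis vector $v(\Lambda)\in V(\lambda,n)$ is $$x_k(\Lambda)=\pm\left(\frac{N-1}{2}+j-i\right),$$ where the upper sign corresponds to the case $\Lambda(k)\supset\Lambda(k-1)$ and the lower sign to the case $\Lambda(k)\subset\Lambda(k-1)$.
   Context: Brauer algebra. For $n\ge1$ let $\mathcal{G}(n)$ be the set of partitions of $\{1,\dots,n,\bar1,\dots,\bar n\}$ into pairs (graphs with $n$ edges). $B(n,N)$ is the complex associative algebra with basis $b(\gamma)$, $\gamma\in\mathcal{G}(n)$, and product $b(\gamma)b(\gamma')=N^{q}b(\gamma\circ\gamma')$: identify the vertices $\bar1,\dots,\bar n$ of $\gamma$ with $1,\dots,n$ of $\gamma'$, let $q$ be the number of loops, remove the loops and replace the other components by single edges joining their terminal vertices to get $\gamma\circ\gamma'$. A permutation $s\in S(n)$ is identified with $b(\gamma)$, $\gamma$ having edges $\{s(m),\bar m\}$. For $k\neq l$, $(k,l)$ is the transposition and $\overline{(k,l)}=b(\gamma)$ with $\gamma$ having edges $\{k,l\},\{\bar k,\bar l\}$ and $\{m,\bar m\}$, $m\ne k,l$. $B(n-1,N)\subset B(n,N)$ is spanned by the $b(\gamma)$ with $\{n,\bar n\}\in\gamma$.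 For $k=1,\dots,n$, $x_k=\frac{N-1}{2}+\sum_{l=1}^{k-1}\bigl((k,l)-\overline{(k,l)}\bigr)$. Representations. $N$ is a positive integer, $U=\mathbb{C}^N$ with standard orthonormal basis $u(1),\dots,u(N)$, $G=O(N,\mathbb{C})$, $C(n,N)=\operatorname{End}_G(U^{\otimes n})$. $B(n,N)$ maps onto $C(n,N)$: $(k,l)$ permutes the $k$-th and $l$-th tensor factors, and $\overline{(k,l)}$ sends $u(i_1)\otimes\cdots\otimes u(i_n)$ to $\delta_{i_k i_l}\sum_{i=1}^N$ of the same tensor with both the $k$-th and $l$-th factors replaced by $u(i)$. $\mathcal{O}(n,N)$ is the set of Young diagrams with at most $N$ boxes in the first two columns together and with $n-2r$ boxes in total, $r=0,1,\dots,[n/2]$ ($\mathcal{O}(0,N)$ consists of the empty diagram). For such a diagram $\lambda$ with $m$ boxes, $U(\lambda,N)$ is Weyl's irreducible representation of $G$: the space of traceless tensors in $U^{\otimes m}$ (those killed by all $\overline{(k,l)}$) decomposes under $G\times S(m)$ as $\bigoplus_\lambda U(\lambda,N)\otimes S^\lambda$, over diagrams $\lambda$ with $m$ boxes and at most $N$ boxes in the first two columns, $S^\lambda$ being the irreducible $S(m)$-module of $\lambda$ (trivial for a one-row diagram). One has $U^{\otimes n}=\bigoplus_{\lambda\in\mathcal{O}(n,N)}U(\lambda,N)\otimes V(\lambda,n)$ with $V(\lambda,n)$ the irreducible $C(n,N)$-modules, also regarded as $B(n,N)$-modules. The restriction of $V(\lambda,n)$ to $C(n-1,N)$ is the multiplicity-free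 direct sum of $V(\mu,n-1)$ over $\mu\in\mathcal{O}(n-1,N)$ obtained from $\lambda$ by removing or adding one box. Canonical basis. $\mathcal{L}(\lambda,n)$ is the set of sequences $\Lambda=(\Lambda(1),\dots,\Lambda(n))\in\mathcal{O}(1,N)\times\cdots\times\mathcal{O}(n,N)$ with $\Lambda(n)=\lambda$ and neighbouring terms differing by exactly one box; $\Lambda(0)$ is the empty diagram. The canonical basis of $V(\lambda,n)$ consists of vectors $v(\Lambda)$, $\Lambda\in\mathcal{L}(\lambda,n)$, determined up to nonzero scalars by: $v(\Lambda)$ lies in the component $V(\Lambda(k),k)$ of the restriction of $V(\lambda,n)$ to $C(k,N)$ for every $k=1,\dots,n-1$. Each $v(\Lambda)$ is an eigenvector of $x_1,\dots,x_n$; $x_k(\Lambda)$ denotes the eigenvalue of $x_k$ on $v(\Lambda)$. *)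

theory Defs
  imports
    Complex_Main
    "HOL-Library.FuncSet"
    "HOL-Library.Disjoint_Sets"
    "HOL-Library.Function_Algebras"
    "HOL-Combinatorics.Permutations"
    "Jordan_Normal_Form.Matrix"
begin

section \<open>Complex vector spaces of functions\<close>

text \<open>All modules below are subspaces of types of the form
  \<open>'a \<Rightarrow> \<dots> \<Rightarrow> complex\<close> with pointwise operations.\<close>

class complex_space = ab_group_add +
  fixes scaleC :: "complex \<Rightarrow> 'a \<Rightarrow> 'a" (infixr "*\<^sub>C" 75)
  assumes scaleC_add_right: "a *\<^sub>C (x + y) = a *\<^sub>C x + a *\<^sub>C y"
    and scaleC_add_left: "(a + b) *\<^sub>C x = a *\<^sub>C x + b *\<^sub>C x"
    and scaleC_scaleC: "a *\<^sub>C (b *\<^sub>C x) = (a * b) *\<^sub>C x"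
    and scaleC_one: "1 *\<^sub>C x = x"

instantiation complex :: complex_space
begin
definition scaleC_complex :: "complex \<Rightarrow> complex \<Rightarrow> complex" where
  "scaleC_complex a x = a * x"
instance by standard (simp_all add: scaleC_complex_def algebra_simps)
end

instantiation "fun" :: (type, complex_space) complex_space
begin
definition scaleC_fun :: "complex \<Rightarrow> ('a \<Rightarrow> 'b) \<Rightarrow> 'a \<Rightarrow> 'b" where
  "scaleC_fun a f = (\<lambda>x. a *\<^sub>C f x)"
instance
  by standard
    (simp_all add: scaleC_fun_def fun_eq_iff scaleC_add_right scaleC_add_left
      scaleC_scaleC scaleC_one)
end

interpretation complex_space: vector_space "scaleC :: complex \<Rightarrow> 'a \<Rightarrow> 'a::complex_space"
  by standard (simp_all add: scaleC_add_right scaleC_add_left scaleC_scaleC scaleC_one)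

text \<open>\<open>intertwiners A \<rho> V \<sigma> W\<close> is \<open>Hom\<^sub>A(V, W)\<close>, where \<open>a \<in> A\<close> acts on
  the subspaces \<open>V\<close> and \<open>W\<close> by \<open>\<rho> a\<close> and \<open>\<sigma> a\<close>.  A linear map
  on \<open>V\<close> is represented by its extension by \<open>0\<close> outside \<open>V\<close>, so that these
  Hom spaces are again complex vector spaces under pointwise operations.\<close>

definition intertwiners ::
  "'g set \<Rightarrow> ('g \<Rightarrow> 'v \<Rightarrow> 'v) \<Rightarrow> 'v::complex_space set \<Rightarrow>
   ('g \<Rightarrow> 'w \<Rightarrow> 'w) \<Rightarrow> 'w::complex_space set \<Rightarrow> ('v \<Rightarrow> 'w) set"
where
  "intertwiners A \<rho> V \<sigma> W = {f.
     (\<forall>x\<in>V. f x \<in> W) \<and>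
     (\<forall>x. x \<notin> V \<longrightarrow> f x = 0) \<and>
     (\<forall>x\<in>V. \<forall>y\<in>V. f (x + y) = f x + f y) \<and>
     (\<forall>c. \<forall>x\<in>V. f (c *\<^sub>C x) = c *\<^sub>C f x) \<and>
     (\<forall>a\<in>A. \<forall>x\<in>V. f (\<rho> a x) = \<sigma> a (f x))}"

text \<open>The component of type \<open>V\<close> of an \<open>A\<close>-module \<open>M\<close>, for \<open>V\<close> irreducible:
  the sum of all submodules of \<open>M\<close> isomorphic to \<open>V\<close>.\<close>

definition isotypic_component ::
  "'g set \<Rightarrow> ('g \<Rightarrow> 'v \<Rightarrow> 'v) \<Rightarrow> 'v::complex_space set \<Rightarrow>
   ('g \<Rightarrow> 'w \<Rightarrow> 'w) \<Rightarrow> 'w::complex_space set \<Rightarrow> 'w set"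
where
  "isotypic_component A \<rho> V \<sigma> M =
     complex_space.span (\<Union>f\<in>intertwiners A \<rho> V \<sigma> M. f ` V)"


section \<open>The Brauer algebra\<close>

datatype vertex = Pt nat | Bar nat

definition brauer_vertices :: "nat \<Rightarrow> vertex set" where
  "brauer_vertices n = Pt ` {1..n} \<union> Bar ` {1..n}"

definition brauer_graphs :: "nat \<Rightarrow> vertex set set set" where
  "brauer_graphs n = {\<gamma>. partition_on (brauer_vertices n) \<gamma> \<and> (\<forall>e\<in>\<gamma>. card e = 2)}"

text \<open>Stacking \<open>\<gamma>\<close> on top of \<open>\<gamma>'\<close>: level \<open>0\<close> carries the vertices \<open>a\<close> of
  \<open>\<gamma>\<close>, level \<open>1\<close> the vertices \<open>Bar a\<close> of \<open>\<gamma>\<close> identified with the vertices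
  \<open>a\<close> of \<open>\<gamma>'\<close>, and level \<open>2\<close> the vertices \<open>Bar a\<close> of \<open>\<gamma>'\<close>.  The loops
  are the components that lie entirely on level \<open>1\<close>.\<close>

fun stack_vertex :: "nat \<Rightarrow> vertex \<Rightarrow> nat \<times> nat" where
  "stack_vertex d (Pt a) = (a, d)"
| "stack_vertex d (Bar a) = (a, Suc d)"

definition stacked_edges :: "vertex set set \<Rightarrow> vertex set set \<Rightarrow> (nat \<times> nat) set set" where
  "stacked_edges \<gamma> \<gamma>' = (\<lambda>e. stack_vertex 0 ` e) ` \<gamma> \<union> (\<lambda>e. stack_vertex 1 ` e) ` \<gamma>'"

definition edge_rel :: "'v set set \<Rightarrow> ('v \<times> 'v) set" where
  "edge_rel E = {(x, y). \<exists>e\<in>E. x \<in> e \<and> y \<in> e}"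

definition stacked_components :: "vertex set set \<Rightarrow> vertex set set \<Rightarrow> (nat \<times> nat) set set" where
  "stacked_components \<gamma> \<gamma>' =
     \<Union>(stacked_edges \<gamma> \<gamma>') // (edge_rel (stacked_edges \<gamma> \<gamma>'))\<^sup>*"

definition stacked_loops :: "vertex set set \<Rightarrow> vertex set set \<Rightarrow> (nat \<times> nat) set set" where
  "stacked_loops \<gamma> \<gamma>' = {K \<in> stacked_components \<gamma> \<gamma>'. K \<subseteq> UNIV \<times> {1}}"

definition graph_comp :: "vertex set set \<Rightarrow> vertex set set \<Rightarrow> vertex set set" where
  "graph_comp \<gamma> \<gamma>' =
     (\<lambda>K. {Pt a |a. (a, 0) \<in> K} \<union> {Bar a |a. (a, 2) \<in> K}) `
       (stacked_components \<gamma> \<gamma>' - stacked_loops \<gamma> \<gamma>')"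

type_synonym brauer = "vertex set set \<Rightarrow> complex"

definition brauer_algebra :: "nat \<Rightarrow> brauer set" where
  "brauer_algebra n = {x. \<forall>\<gamma>. \<gamma> \<notin> brauer_graphs n \<longrightarrow> x \<gamma> = 0}"

definition brauer_basis :: "vertex set set \<Rightarrow> brauer" where
  "brauer_basis \<gamma> = (\<lambda>\<gamma>'. if \<gamma>' = \<gamma> then 1 else 0)"

definition brauer_mult :: "nat \<Rightarrow> nat \<Rightarrow> brauer \<Rightarrow> brauer \<Rightarrow> brauer" where
  "brauer_mult N n x y =
     (\<Sum>\<gamma>\<in>brauer_graphs n. \<Sum>\<gamma>'\<in>brauer_graphs n.
        (x \<gamma> * y \<gamma>' * of_nat N ^ card (stacked_loops \<gamma> \<gamma>')) *\<^sub>C brauer_basis (graph_comp \<gamma> \<gamma>'))"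

definition perm_graph :: "nat \<Rightarrow> (nat \<Rightarrow> nat) \<Rightarrow> vertex set set" where
  "perm_graph n s = {{Pt (s m), Bar m} |m. m \<in> {1..n}}"

definition bar_graph :: "nat \<Rightarrow> nat \<Rightarrow> nat \<Rightarrow> vertex set set" where
  "bar_graph n k l =
     {{Pt k, Pt l}, {Bar k, Bar l}} \<union> {{Pt m, Bar m} |m. m \<in> {1..n} - {k, l}}"

text \<open>The element \<open>x\<^sub>k\<close> of \<open>B(n, N)\<close>.\<close>

definition jucys_murphy :: "nat \<Rightarrow> nat \<Rightarrow> nat \<Rightarrow> brauer" where
  "jucys_murphy N n k =
     ((of_nat N - 1) / 2) *\<^sub>C brauer_basis (perm_graph n id) +
     (\<Sum>l\<in>{1..<k}. brauer_basis (perm_graph n (transpose k l)) - brauer_basis (bar_graph n k l))"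


section \<open>Tensors, the orthogonal group and its centralizer algebra\<close>

text \<open>The tensors \<open>t\<close> in the \<open>n\<close>-th tensor power of \<open>U\<close> are given by their coordinates
  \<open>t i\<close> with respect to the basis \<open>u(i 1) \<otimes> \<dots> \<otimes> u(i n)\<close>.  The standard basis of
  \<open>U\<close> is indexed by \<open>0, \<dots>, N - 1\<close>, in accordance with the indices of matrices.\<close>

type_synonym tensor = "(nat \<Rightarrow> nat) \<Rightarrow> complex"

definition multi_indices :: "nat \<Rightarrow> nat \<Rightarrow> (nat \<Rightarrow> nat) set" where
  "multi_indices N n = {1..n} \<rightarrow>\<^sub>E {..<N}"

definition tensors :: "nat \<Rightarrow> nat \<Rightarrow> tensor set" where
  "tensors N n = {t. \<forall>i. i \<notin> multi_indices N n \<longrightarrow> t i = 0}"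

definition basis_tensor :: "(nat \<Rightarrow> nat) \<Rightarrow> tensor" where
  "basis_tensor j = (\<lambda>i. if i = j then 1 else 0)"

definition orthogonal_group :: "nat \<Rightarrow> complex mat set" where
  "orthogonal_group N = {g \<in> carrier_mat N N. g * transpose_mat g = 1\<^sub>m N}"

definition tensor_act :: "nat \<Rightarrow> nat \<Rightarrow> complex mat \<Rightarrow> tensor \<Rightarrow> tensor" where
  "tensor_act N n g t = (\<lambda>i. if i \<in> multi_indices N n
     then \<Sum>j\<in>multi_indices N n. (\<Prod>a\<in>{1..n}. g $$ (i a, j a)) * t j else 0)"

text \<open>\<open>C(n, N)\<close>, with composition as multiplication.\<close>

definition centralizer_algebra :: "nat \<Rightarrow> nat \<Rightarrow> (tensor \<Rightarrow> tensor) set" where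
  "centralizer_algebra N n =
     intertwiners (orthogonal_group N) (tensor_act N n) (tensors N n)
       (tensor_act N n) (tensors N n)"

text \<open>For \<open>k \<le> n\<close>, the embedding \<open>c \<mapsto> c \<otimes> 1\<close> of \<open>C(k, N)\<close> into \<open>C(n, N)\<close>, with
  \<open>c\<close> acting in the first \<open>k\<close> tensor factors.\<close>

definition centralizer_embed ::
  "nat \<Rightarrow> nat \<Rightarrow> nat \<Rightarrow> (tensor \<Rightarrow> tensor) \<Rightarrow> tensor \<Rightarrow> tensor" where
  "centralizer_embed N k n c t = (if t \<in> tensors N n then
     (\<lambda>i. if i \<in> multi_indices N n
       then c (\<lambda>j. if j \<in> multi_indices N k then t (\<lambda>a. if a \<in> {1..k} then j a else i a) else 0)
              (restrict i {1..k})
       else 0) else 0)"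


section \<open>The action of the Brauer algebra on tensors\<close>

text \<open>The coefficient of \<open>u(i 1) \<otimes> \<dots> \<otimes> u(i n)\<close> in the image of
  \<open>u(j 1) \<otimes> \<dots> \<otimes> u(j n)\<close> under \<open>b(\<gamma>)\<close> is \<open>1\<close> if the labelling of the vertices
  \<open>a\<close> by \<open>i a\<close> and \<open>Bar a\<close> by \<open>j a\<close> is constant on every edge of \<open>\<gamma>\<close>, and
  \<open>0\<close> otherwise.\<close>

fun vertex_label :: "(nat \<Rightarrow> nat) \<Rightarrow> (nat \<Rightarrow> nat) \<Rightarrow> vertex \<Rightarrow> nat" where
  "vertex_label i j (Pt a) = i a"
| "vertex_label i j (Bar a) = j a"

definition constant_on_edges :: "('v \<Rightarrow> nat) \<Rightarrow> 'v set set \<Rightarrow> bool" where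
  "constant_on_edges f \<gamma> \<longleftrightarrow> (\<forall>e\<in>\<gamma>. \<forall>x\<in>e. \<forall>y\<in>e. f x = f y)"

definition graph_act :: "nat \<Rightarrow> nat \<Rightarrow> vertex set set \<Rightarrow> tensor \<Rightarrow> tensor" where
  "graph_act N n \<gamma> t = (\<lambda>i. if i \<in> multi_indices N n
     then \<Sum>j\<in>multi_indices N n. if constant_on_edges (vertex_label i j) \<gamma> then t j else 0 else 0)"

definition brauer_rep :: "nat \<Rightarrow> nat \<Rightarrow> brauer \<Rightarrow> tensor \<Rightarrow> tensor" where
  "brauer_rep N n x t = (if t \<in> tensors N n
     then \<Sum>\<gamma>\<in>brauer_graphs n. x \<gamma> *\<^sub>C graph_act N n \<gamma> t else 0)"


subsection \<open>Consistency of the definitions\<close>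

text \<open>The transpositions and the elements \<open>b(bar_graph n k l)\<close> act on tensors by permuting and
  contracting factors (\<open>brauer_rep_perm\<close>, \<open>brauer_rep_bar\<close>), and the action respects the product of
  \<open>B(n, N)\<close> (\<open>graph_act_comp\<close>).\<close>

lemma finite_multi_indices: "finite (multi_indices N n)"
  unfolding multi_indices_def by (simp add: finite_PiE)

lemma finite_brauer_graphs: "finite (brauer_graphs n)"
proof (rule finite_subset)
  show "brauer_graphs n \<subseteq> Pow (Pow (brauer_vertices n))"
    unfolding brauer_graphs_def partition_on_def by auto
  show "finite (Pow (Pow (brauer_vertices n)))"
    by (simp add: brauer_vertices_def)
qed

lemma graph_act_mem: "graph_act N n \<gamma> t \<in> tensors N n"
  by (simp add: tensors_def graph_act_def)

lemma brauer_rep_basis: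
  assumes "\<gamma> \<in> brauer_graphs n" "t \<in> tensors N n"
  shows "brauer_rep N n (brauer_basis \<gamma>) t = graph_act N n \<gamma> t"
proof -
  have "brauer_rep N n (brauer_basis \<gamma>) t =
      (\<Sum>\<gamma>'\<in>brauer_graphs n. if \<gamma>' = \<gamma> then graph_act N n \<gamma>' t else 0)"
    unfolding brauer_rep_def using assms(2)
    by (auto simp: brauer_basis_def scaleC_one intro!: sum.cong)
  then show ?thesis
    using assms(1) by (simp add: finite_brauer_graphs)
qed

lemma graph_act_basis_tensor:
  assumes "j \<in> multi_indices N n"
  shows "graph_act N n \<gamma> (basis_tensor j) = (\<lambda>i.
    if i \<in> multi_indices N n \<and> constant_on_edges (vertex_label i j) \<gamma> then 1 else 0)"
proof
  fix i
  have "(\<Sum>j'\<in>multi_indices N n. if constant_on_edges (vertex_label i j') \<gamma> then basis_tensor j j' else 0)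
    = (\<Sum>j'\<in>multi_indices N n. if j' = j then (if constant_on_edges (vertex_label i j) \<gamma> then 1 else 0) else 0)"
    by (rule sum.cong) (auto simp: basis_tensor_def)
  then show "graph_act N n \<gamma> (basis_tensor j) i = (
    if i \<in> multi_indices N n \<and> constant_on_edges (vertex_label i j) \<gamma> then 1 else 0)"
    using assms by (simp add: graph_act_def finite_multi_indices)
qed

lemma perm_graph_mem:
  assumes "s permutes {1..n}"
  shows "perm_graph n s \<in> brauer_graphs n"
proof -
  have inj: "s a = s b \<longleftrightarrow> a = b" for a b
    using permutes_inj[OF assms] by (auto simp: inj_def)
  have img: "s ` {1..n} = {1..n}" using permutes_image[OF assms] .
  have "\<Union>(perm_graph n s) = Pt ` s ` {1..n} \<union> Bar ` {1..n}"
    unfolding perm_graph_def by blast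
  then show ?thesis
    unfolding brauer_graphs_def partition_on_def brauer_vertices_def img
    by (auto simp: perm_graph_def disjoint_def inj)
qed

lemma bar_graph_mem:
  assumes "k \<in> {1..n}" "l \<in> {1..n}" "k \<noteq> l"
  shows "bar_graph n k l \<in> brauer_graphs n"
proof -
  have "\<Union>(bar_graph n k l) = Pt ` {1..n} \<union> Bar ` {1..n}"
    unfolding bar_graph_def using assms by blast
  then show ?thesis
    unfolding brauer_graphs_def partition_on_def brauer_vertices_def
    using assms by (auto simp: bar_graph_def disjoint_def)
qed

lemma jucys_murphy_mem:
  assumes "k \<in> {1..n}"
  shows "jucys_murphy N n k \<in> brauer_algebra n"
proof -
  have sum: "(\<Sum>l\<in>A. f l) \<gamma> = (\<Sum>l\<in>A. f l \<gamma>)" for A :: "nat set" and f :: "nat \<Rightarrow> brauer" and \<gamma>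
    by (induction A rule: infinite_finite_induct) auto
  have "perm_graph n id \<in> brauer_graphs n"
    by (rule perm_graph_mem) (simp add: permutes_id)
  moreover have "perm_graph n (transpose k l) \<in> brauer_graphs n"
    and "bar_graph n k l \<in> brauer_graphs n" if "l \<in> {1..<k}" for l
    using assms that by (auto intro!: perm_graph_mem bar_graph_mem permutes_swap_id)
  ultimately have zero: "brauer_basis (perm_graph n id) \<gamma> = 0"
    "\<forall>l\<in>{1..<k}. brauer_basis (perm_graph n (transpose k l)) \<gamma> - brauer_basis (bar_graph n k l) \<gamma> = 0"
    if "\<gamma> \<notin> brauer_graphs n" for \<gamma>
    using that unfolding brauer_basis_def by (metis, metis diff_self)
  show ?thesis
    unfolding jucys_murphy_def brauer_algebra_def mem_Collect_eq
  proof (intro allI impI)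
    fix \<gamma> assume "\<gamma> \<notin> brauer_graphs n"
    note z = zero[OF this]
    show "(((of_nat N - 1) / 2) *\<^sub>C brauer_basis (perm_graph n id) +
      (\<Sum>l\<in>{1..<k}. brauer_basis (perm_graph n (transpose k l)) - brauer_basis (bar_graph n k l))) \<gamma> = 0"
      using z by (simp add: sum scaleC_fun_def scaleC_complex_def del: atLeastLessThan_iff)
  qed
qed

lemma brauer_rep_perm:
  assumes s: "s permutes {1..n}" and j: "j \<in> multi_indices N n"
  shows "brauer_rep N n (brauer_basis (perm_graph n s)) (basis_tensor j) =
    basis_tensor (j \<circ> inv_into UNIV s)"
proof -
  have t: "basis_tensor j \<in> tensors N n"
    using j by (auto simp: tensors_def basis_tensor_def)
  have si: "inv_into UNIV s permutes {1..n}" using permutes_inv[OF s] .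
  have mem: "j \<circ> inv_into UNIV s \<in> multi_indices N n"
    using j permutes_in_image[OF si] permutes_not_in[OF si]
    by (auto simp: multi_indices_def PiE_iff extensional_def)
  have "constant_on_edges (vertex_label i j) (perm_graph n s) \<longleftrightarrow> i = j \<circ> inv_into UNIV s"
    if i: "i \<in> multi_indices N n" for i
  proof -
    have "constant_on_edges (vertex_label i j) (perm_graph n s) \<longleftrightarrow> (\<forall>m\<in>{1..n}. i (s m) = j m)"
      unfolding perm_graph_def Setcompr_eq_image by (auto simp: constant_on_edges_def)
    also have "\<dots> \<longleftrightarrow> (\<forall>m\<in>{1..n}. i m = j (inv_into UNIV s m))"
      using permutes_in_image[OF si] permutes_in_image[OF s] permutes_inverses[OF s] by metis
    also have "\<dots> \<longleftrightarrow> i = j \<circ> inv_into UNIV s"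
    proof
      assume "\<forall>m\<in>{1..n}. i m = j (inv_into UNIV s m)"
      then show "i = j \<circ> inv_into UNIV s"
        by (intro PiE_ext[OF i[unfolded multi_indices_def] mem[unfolded multi_indices_def]]) simp
    qed simp
    finally show ?thesis .
  qed
  then show ?thesis
    unfolding brauer_rep_basis[OF perm_graph_mem[OF s] t] graph_act_basis_tensor[OF j]
    using mem by (intro ext) (auto simp: basis_tensor_def)
qed

lemma brauer_rep_bar:
  assumes kl: "k \<in> {1..n}" "l \<in> {1..n}" "k \<noteq> l" and j: "j \<in> multi_indices N n"
  shows "brauer_rep N n (brauer_basis (bar_graph n k l)) (basis_tensor j) =
    (if j k = j l then \<Sum>a<N. basis_tensor (j(k := a, l := a)) else 0)"
proof -
  have t: "basis_tensor j \<in> tensors N n"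
    using j by (auto simp: tensors_def basis_tensor_def)
  have sum: "(\<Sum>a<N. f a) i = (\<Sum>a<N. f a i)" for f :: "nat \<Rightarrow> tensor" and i
    by (induction N) auto
  have mem: "j(k := a, l := a) \<in> multi_indices N n" if "a < N" for a
    using j kl that by (auto simp: multi_indices_def PiE_iff extensional_def)
  have edges: "constant_on_edges (vertex_label i j) (bar_graph n k l) \<longleftrightarrow>
      i k = i l \<and> j k = j l \<and> (\<forall>m\<in>{1..n} - {k, l}. i m = j m)" for i
    unfolding bar_graph_def Setcompr_eq_image ball_Un constant_on_edges_def by auto
  have eq: "i = j(k := a, l := a) \<longleftrightarrow> a = i k \<and> i k = i l \<and> (\<forall>m\<in>{1..n} - {k, l}. i m = j m)"
    if i: "i \<in> multi_indices N n" for i a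
  proof -
    have out: "i x = j x" if "x \<notin> {1..n}" for x
      using PiE_arb[OF i[unfolded multi_indices_def] that]
        PiE_arb[OF j[unfolded multi_indices_def] that] by simp
    show ?thesis
    proof
      assume "i = j(k := a, l := a)"
      then show "a = i k \<and> i k = i l \<and> (\<forall>m\<in>{1..n} - {k, l}. i m = j m)"
        using kl by auto
    next
      assume r: "a = i k \<and> i k = i l \<and> (\<forall>m\<in>{1..n} - {k, l}. i m = j m)"
      show "i = j(k := a, l := a)"
      proof
        fix x
        show "i x = (j(k := a, l := a)) x"
          using r out[of x] by (cases "x \<in> {1..n}") auto
      qed
    qed
  qed
  show ?thesis
  proof
    fix i
    show "brauer_rep N n (brauer_basis (bar_graph n k l)) (basis_tensor j) i =
      (if j k = j l then \<Sum>a<N. basis_tensor (j(k := a, l := a)) else 0) i"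
    proof (cases "i \<in> multi_indices N n")
      case True
      then have "i k < N" using kl by (auto simp: multi_indices_def PiE_iff)
      define P where "P \<longleftrightarrow> i k = i l \<and> (\<forall>m\<in>{1..n} - {k, l}. i m = j m)"
      have "(\<Sum>a<N. basis_tensor (j(k := a, l := a)) i) = (\<Sum>a<N. if a = i k then if P then 1 else 0 else 0)"
        by (rule sum.cong) (auto simp: basis_tensor_def eq[OF True] P_def)
      also have "\<dots> = (if P then 1 else 0)" using \<open>i k < N\<close> by simp
      finally have "(\<Sum>a<N. basis_tensor (j(k := a, l := a)) i) = (if P then 1 else 0)" .
      moreover have "constant_on_edges (vertex_label i j) (bar_graph n k l) \<longleftrightarrow> j k = j l \<and> P"
        unfolding edges P_def by blast
      ultimately show ?thesis
        unfolding brauer_rep_basis[OF bar_graph_mem[OF kl] t] graph_act_basis_tensor[OF j]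
        by (simp add: True sum)
    next
      case False
      then have "i \<noteq> j(k := a, l := a)" if "a < N" for a
        using mem[OF that] by auto
      then show ?thesis
        unfolding brauer_rep_basis[OF bar_graph_mem[OF kl] t] graph_act_basis_tensor[OF j]
        using False by (auto simp: sum basis_tensor_def)
    qed
  qed
qed


lemma equiv_edge_rel: "equiv UNIV ((edge_rel E)\<^sup>*)"
proof (rule equivI)
  show "sym ((edge_rel E)\<^sup>*)"
    by (rule sym_rtrancl) (auto simp: sym_def edge_rel_def)
qed (auto simp: refl_rtrancl trans_rtrancl)

lemma constant_on_components:
  "constant_on_edges f E \<longleftrightarrow> constant_on_edges f (\<Union>E // (edge_rel E)\<^sup>*)"
proof
  assume c: "constant_on_edges f E"
  have "f x = f y" if "(x, y) \<in> (edge_rel E)\<^sup>*" for x y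
    using that
    by (induction rule: rtrancl_induct) (use c in \<open>auto simp: constant_on_edges_def edge_rel_def\<close>)
  then show "constant_on_edges f (\<Union>E // (edge_rel E)\<^sup>*)"
    unfolding constant_on_edges_def by (auto elim!: quotientE) (metis (no_types))
next
  assume c: "constant_on_edges f (\<Union>E // (edge_rel E)\<^sup>*)"
  show "constant_on_edges f E"
    unfolding constant_on_edges_def
  proof (intro ballI)
    fix e x y assume e: "e \<in> E" "x \<in> e" "y \<in> e"
    then have "(edge_rel E)\<^sup>* `` {x} \<in> \<Union>E // (edge_rel E)\<^sup>*"
      by (auto simp: quotient_def)
    moreover have "x \<in> (edge_rel E)\<^sup>* `` {x}" "y \<in> (edge_rel E)\<^sup>* `` {x}"
      using e by (auto simp: edge_rel_def)
    ultimately show "f x = f y" using c unfolding constant_on_edges_def by blast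
  qed
qed

lemma card_middle_labellings:
  assumes \<gamma>: "\<gamma> \<in> brauer_graphs n" and \<gamma>': "\<gamma>' \<in> brauer_graphs n"
    and i: "i \<in> multi_indices N n" and k: "k \<in> multi_indices N n"
  shows "card {j \<in> multi_indices N n. constant_on_edges (vertex_label i j) \<gamma> \<and>
      constant_on_edges (vertex_label j k) \<gamma>'} =
    (if constant_on_edges (vertex_label i k) (graph_comp \<gamma> \<gamma>')
     then N ^ card (stacked_loops \<gamma> \<gamma>') else 0)"
proof -
  define E where "E = stacked_edges \<gamma> \<gamma>'"
  define C where "C = stacked_components \<gamma> \<gamma>'"
  define L where "L = stacked_loops \<gamma> \<gamma>'"
  define R where "R = (edge_rel E)\<^sup>*"
  define F where "F = (\<lambda>j (a, d). if d = 0 then i a else if d = Suc 0 then j a else k a :: nat)"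
  define J where "J = {j \<in> multi_indices N n. constant_on_edges (F j) C}"
  have C: "C = \<Union>E // R"
    by (simp add: C_def stacked_components_def E_def R_def edge_rel_def)
  have L: "L = {K \<in> C. K \<subseteq> UNIV \<times> {1}}"
    by (simp add: L_def C_def stacked_loops_def)
  have R: "equiv UNIV R" unfolding R_def by (rule equiv_edge_rel)
  have U: "\<Union>\<gamma> = brauer_vertices n" "\<Union>\<gamma>' = brauer_vertices n"
    using \<gamma> \<gamma>' by (auto simp: brauer_graphs_def partition_on_def)
  have "\<Union>E = stack_vertex 0 ` \<Union>\<gamma> \<union> stack_vertex 1 ` \<Union>\<gamma>'"
    unfolding E_def stacked_edges_def by blast
  also have "\<dots> = {1..n} \<times> {0, 1, 2}"
    unfolding U brauer_vertices_def by (simp add: image_Un image_image) auto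
  finally have UE: "\<Union>E = {1..n} \<times> {0, 1, 2}" .
  have R_cases: "x = y \<or> y \<in> \<Union>E" if "(x, y) \<in> R" for x y
    using that unfolding R_def by (cases rule: rtranclE) (auto simp: edge_rel_def)
  have KV: "K \<subseteq> {1..n} \<times> {0, 1, 2}" if "K \<in> C" for K
    using that R_cases unfolding C UE by (auto simp: quotient_def) 
  have fin_C: "finite C"
    by (rule finite_subset[of _ "Pow ({1..n} \<times> {0, 1, 2})"]) (use KV in auto)
  have ne: "K \<noteq> {}" if "K \<in> C" for K
    using that R unfolding C by (auto simp: quotient_def equiv_def refl_on_def)
  have same: "K = K'" if "K \<in> C" "K' \<in> C" "x \<in> K" "x \<in> K'" for K K' x
  proof -
    have "C \<subseteq> UNIV // R" unfolding C by (auto simp: quotient_def)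
    then show ?thesis using quotient_disj[OF R, of K K'] that by blast
  qed
  have cover: "\<exists>K\<in>C. x \<in> K" if "x \<in> {1..n} \<times> {0, 1, 2}" for x
    using that R unfolding C UE quotient_def by (auto simp: equiv_def refl_on_def)
  have up: "F j (stack_vertex 0 v) = vertex_label i j v" for j v
    by (cases v) (auto simp: F_def)
  have low: "F j (stack_vertex 1 v) = vertex_label j k v" for j v
    by (cases v) (auto simp: F_def)
  have "constant_on_edges (F j) E \<longleftrightarrow>
      constant_on_edges (vertex_label i j) \<gamma> \<and> constant_on_edges (vertex_label j k) \<gamma>'" for j
    unfolding constant_on_edges_def E_def stacked_edges_def
    by (simp add: ball_Un up low flip: One_nat_def)
  then have J: "{j \<in> multi_indices N n. constant_on_edges (vertex_label i j) \<gamma> \<and>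
      constant_on_edges (vertex_label j k) \<gamma>'} = J"
    using constant_on_components[of _ E] by (auto simp: J_def C R_def)
  have comp: "constant_on_edges (vertex_label i k) (graph_comp \<gamma> \<gamma>') \<longleftrightarrow>
    (\<forall>K\<in>C - L. \<forall>x\<in>K. \<forall>y\<in>K. snd x \<noteq> 1 \<longrightarrow> snd y \<noteq> 1 \<longrightarrow> F j x = F j y)" for j
  proof -
    define S where "S K = {Pt a |a. (a, 0) \<in> K} \<union> {Bar a |a. (a, 2) \<in> K}" for K :: "(nat \<times> nat) set"
    have "(\<forall>v\<in>S K. \<forall>w\<in>S K. vertex_label i k v = vertex_label i k w)
       \<longleftrightarrow> (\<forall>x\<in>K. \<forall>y\<in>K. snd x \<noteq> 1 \<longrightarrow> snd y \<noteq> 1 \<longrightarrow> F j x = F j y)"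
      if K: "K \<in> C" for K
    proof -
      have 1: "\<exists>x\<in>K. snd x \<noteq> 1 \<and> F j x = vertex_label i k v" if "v \<in> S K" for v
      proof (cases v)
        case (Pt a)
        with that show ?thesis by (intro bexI[of _ "(a, 0)"]) (auto simp: S_def F_def)
      next
        case (Bar a)
        with that show ?thesis by (intro bexI[of _ "(a, 2)"]) (auto simp: S_def F_def)
      qed
      have 2: "\<exists>v\<in>S K. F j x = vertex_label i k v" if x: "x \<in> K" "snd x \<noteq> 1" for x
      proof -
        obtain a d where eq: "x = (a, d)" by (cases x)
        consider "d = 0" | "d = 2" using KV[OF K] x eq by auto
        then show ?thesis
        proof cases
          case 1
          with x eq show ?thesis by (intro bexI[of _ "Pt a"]) (auto simp: S_def F_def)
        next
          case 2
          with x eq show ?thesis by (intro bexI[of _ "Bar a"]) (auto simp: S_def F_def)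
        qed
      qed
      show ?thesis using 1 2 by metis
    qed
    then show ?thesis
      unfolding constant_on_edges_def graph_comp_def L_def[symmetric] C_def[symmetric]
      by (simp flip: S_def)
  qed
  show ?thesis
  proof (cases "constant_on_edges (vertex_label i k) (graph_comp \<gamma> \<gamma>')")
    case False
    have "J = {}"
    proof (rule ccontr)
      assume "J \<noteq> {}"
      then obtain j where "constant_on_edges (F j) C" unfolding J_def by blast
      then have c: "F j x = F j y" if "K \<in> C" "x \<in> K" "y \<in> K" for K x y
        using that unfolding constant_on_edges_def by blast
      have "constant_on_edges (vertex_label i k) (graph_comp \<gamma> \<gamma>')"
        by (subst comp[of j], intro ballI impI) (erule DiffE, erule (2) c)
      with False show False ..
    qed
    then show ?thesis unfolding J using False by simp
  next
    case True
    define cl where "cl x = (THE K. K \<in> C \<and> x \<in> K)" for x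
    have cl: "cl x = K" if "K \<in> C" "x \<in> K" for x K
      unfolding cl_def
    proof (rule the_equality)
      fix K' assume "K' \<in> C \<and> x \<in> K'"
      then show "K' = K" using same[of K' K x] that by simp
    qed (use that in simp)
    define rep where "rep K = (SOME x. x \<in> K \<and> (K \<in> L \<or> snd x \<noteq> 1))" for K
    have rep: "rep K \<in> K \<and> (K \<in> L \<or> snd (rep K) \<noteq> 1)" if K: "K \<in> C" for K
      unfolding rep_def
    proof (rule someI_ex)
      show "\<exists>x. x \<in> K \<and> (K \<in> L \<or> snd x \<noteq> 1)"
      proof (cases "K \<in> L")
        case True
        then show ?thesis using ne[OF K] by blast
      next
        case False
        then obtain x where "x \<in> K" "x \<notin> UNIV \<times> {1}" using K unfolding L by blast
        then show ?thesis by (intro exI[of _ x]) (cases x, simp)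
      qed
    qed
    define f where "f j = (\<lambda>K\<in>L. j (fst (rep K)))" for j :: "nat \<Rightarrow> nat"
    define g where "g h = (\<lambda>a\<in>{1..n}. if cl (a, 1) \<in> L then h (cl (a, 1)) else F undefined (rep (cl (a, 1))))"
      for h :: "(nat \<times> nat) set \<Rightarrow> nat"
    have LC: "K \<in> C" if "K \<in> L" for K using that by (simp add: L)
    have clC: "cl x \<in> C \<and> x \<in> cl x" if x: "x \<in> {1..n} \<times> {0, 1, 2}" for x
    proof -
      obtain K where K: "K \<in> C" "x \<in> K" using cover[OF x] by blast
      show ?thesis using K unfolding cl[OF K] by simp
    qed
    have level: "F j x = F j' x" if "snd x \<noteq> 1" for j j' x
      using that by (auto simp: F_def split: prod.split)
    have repL: "F j (rep K) = j (fst (rep K))" "fst (rep K) \<in> {1..n}" if K: "K \<in> L" for j K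
    proof -
      have "rep K \<in> K" "K \<subseteq> UNIV \<times> {1}" using rep[OF LC[OF K]] K unfolding L by auto
      then obtain a where a: "rep K = (a, 1)" by blast
      then show "F j (rep K) = j (fst (rep K))" by (simp add: F_def)
      have "rep K \<in> {1..n} \<times> {0, 1, 2}" using KV[OF LC[OF K]] \<open>rep K \<in> K\<close> by blast
      then show "fst (rep K) \<in> {1..n}" using a by simp
    qed
    have bound: "F undefined x < N" if "x \<in> {1..n} \<times> {0, 1, 2}" "snd x \<noteq> 1" for x
      using that i k by (auto simp: F_def multi_indices_def PiE_iff split: prod.split)
    have g_mem: "g h \<in> multi_indices N n" if h: "h \<in> L \<rightarrow>\<^sub>E {..<N}" for h
    proof -
      have "(if cl (a, 1) \<in> L then h (cl (a, 1)) else F undefined (rep (cl (a, 1)))) < N"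
        if a: "a \<in> {1..n}" for a
      proof -
        have c: "cl (a, 1) \<in> C" using clC[of "(a, 1)"] a by simp
        show ?thesis
        proof (cases "cl (a, 1) \<in> L")
          case True
          then show ?thesis using h by (auto simp: PiE_iff)
        next
          case False
          have "F undefined (rep (cl (a, 1))) < N"
            by (rule bound) (use rep[OF c] KV[OF c] False in blast)+
          then show ?thesis using False by simp
        qed
      qed
      then show ?thesis by (simp add: multi_indices_def g_def)
    qed
    have Fg: "F (g h) x = (if K \<in> L then h K else F undefined (rep K))"
      if K: "K \<in> C" "x \<in> K" for h x K
    proof (cases "snd x = 1")
      case True
      then obtain a where a: "x = (a, 1)" by (cases x) auto
      then have "a \<in> {1..n}" using KV[OF K(1)] K(2) by auto
      moreover have "cl (a, 1) = K" using cl[OF K] a by simp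
      ultimately show ?thesis using a by (simp add: F_def g_def)
    next
      case False
      then have KL: "K \<notin> L" using K(2) by (auto simp: L)
      have "F undefined x = F undefined (rep K)"
        using True[unfolded comp[of undefined]] KL K False rep[OF K(1)] by blast
      then show ?thesis using KL level[OF False, of "g h" undefined] by simp
    qed
    have g_J: "g h \<in> J" if "h \<in> L \<rightarrow>\<^sub>E {..<N}" for h
      using g_mem[OF that] Fg by (simp add: J_def constant_on_edges_def)
    have f_mem: "f j \<in> L \<rightarrow>\<^sub>E {..<N}" if "j \<in> J" for j
      using that repL(2) by (auto simp: f_def J_def multi_indices_def PiE_iff)
    have fg: "f (g h) = h" if h: "h \<in> L \<rightarrow>\<^sub>E {..<N}" for h
    proof (rule PiE_ext[OF f_mem[OF g_J[OF h]] h])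
      fix K assume K: "K \<in> L"
      then show "f (g h) K = h K"
        using Fg[OF LC[OF K], of "rep K" h] rep[OF LC[OF K]] repL(1)[OF K, of "g h"]
        by (simp add: f_def)
    qed
    have gf: "g (f j) = j" if j: "j \<in> J" for j
    proof -
      have j': "j \<in> multi_indices N n" and c: "constant_on_edges (F j) C"
        using j by (auto simp: J_def)
      have "g (f j) a = j a" if a: "a \<in> {1..n}" for a
      proof -
        define K where "K = cl (a, 1)"
        have K: "K \<in> C" "(a, 1) \<in> K" using clC[of "(a, 1)"] a by (auto simp: K_def)
        have "j a = F j (a, 1)" by (simp add: F_def)
        also have "\<dots> = F j (rep K)"
          using c K rep[OF K(1)] unfolding constant_on_edges_def by blast
        also have "\<dots> = F (g (f j)) (a, 1)"
        proof (cases "K \<in> L")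
          case True
          then show ?thesis unfolding Fg[OF K] by (simp add: repL(1) f_def)
        next
          case False
          then show ?thesis unfolding Fg[OF K] using level[of "rep K" j undefined] rep[OF K(1)] by simp
        qed
        also have "\<dots> = g (f j) a" by (simp add: F_def)
        finally show ?thesis by simp
      qed
      then show ?thesis
        using j' g_mem[OF f_mem[OF j]] unfolding multi_indices_def by (intro PiE_ext) auto
    qed
    have "bij_betw f J (L \<rightarrow>\<^sub>E {..<N})"
      by (rule bij_betw_byWitness[where f' = g]) (use fg gf f_mem g_J in auto)
    then have "card J = card (L \<rightarrow>\<^sub>E {..<N})" by (rule bij_betw_same_card)
    also have "\<dots> = N ^ card L"
      using fin_C by (subst card_PiE) (auto simp: L)
    finally show ?thesis unfolding J using True by (simp add: L_def)
  qed
qed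

lemma graph_act_comp:
  assumes "\<gamma> \<in> brauer_graphs n" "\<gamma>' \<in> brauer_graphs n"
  shows "graph_act N n \<gamma> (graph_act N n \<gamma>' t) =
    of_nat N ^ card (stacked_loops \<gamma> \<gamma>') *\<^sub>C graph_act N n (graph_comp \<gamma> \<gamma>') t"
proof
  fix i
  show "graph_act N n \<gamma> (graph_act N n \<gamma>' t) i =
    (of_nat N ^ card (stacked_loops \<gamma> \<gamma>') *\<^sub>C graph_act N n (graph_comp \<gamma> \<gamma>') t) i"
  proof (cases "i \<in> multi_indices N n")
    case True
    let ?I = "multi_indices N n" and ?q = "card (stacked_loops \<gamma> \<gamma>')"
    let ?P = "\<lambda>j. constant_on_edges (vertex_label i j) \<gamma>"
    let ?Q = "\<lambda>j k. constant_on_edges (vertex_label j k) \<gamma>'"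
    have "graph_act N n \<gamma> (graph_act N n \<gamma>' t) i =
        (\<Sum>j\<in>?I. \<Sum>k\<in>?I. if ?P j \<and> ?Q j k then t k else 0)"
      using True by (auto simp: graph_act_def intro!: sum.cong)
    also have "\<dots> = (\<Sum>k\<in>?I. \<Sum>j\<in>?I. if ?P j \<and> ?Q j k then t k else 0)"
      by (rule sum.swap)
    also have "\<dots> = (\<Sum>k\<in>?I. of_nat (card {j \<in> ?I. ?P j \<and> ?Q j k}) * t k)"
      by (rule sum.cong) (simp_all add: sum.If_cases finite_multi_indices Int_def)
    also have "\<dots> = (\<Sum>k\<in>?I. of_nat N ^ ?q *
        (if constant_on_edges (vertex_label i k) (graph_comp \<gamma> \<gamma>') then t k else 0))"
      by (rule sum.cong) (simp_all add: card_middle_labellings[OF assms True])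
    also have "\<dots> = (of_nat N ^ ?q *\<^sub>C graph_act N n (graph_comp \<gamma> \<gamma>') t) i"
      using True by (simp add: graph_act_def scaleC_fun_def scaleC_complex_def sum_distrib_left)
    finally show ?thesis .
  qed (simp add: graph_act_def scaleC_fun_def scaleC_complex_def)
qed


section \<open>Young diagrams and the irreducible modules of the symmetric group\<close>

text \<open>A diagram is the set of its boxes \<open>(row, column)\<close>, counted from \<open>1\<close>.\<close>

type_synonym diagram = "(nat \<times> nat) set"

definition young_diagram :: "diagram \<Rightarrow> bool" where
  "young_diagram lam \<longleftrightarrow> finite lam \<and> lam \<subseteq> {1..} \<times> {1..} \<and>
     (\<forall>i j i' j'. (i, j) \<in> lam \<longrightarrow> i' \<in> {1..i} \<longrightarrow> j' \<in> {1..j} \<longrightarrow> (i', j') \<in> lam)"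

definition orthogonal_diagrams :: "nat \<Rightarrow> nat \<Rightarrow> diagram set" where
  "orthogonal_diagrams n N = {lam. young_diagram lam \<and>
     card {b \<in> lam. snd b \<in> {1, 2}} \<le> N \<and> (\<exists>r. n = card lam + 2 * r)}"

text \<open>The number of a box in the standard tableau filled row by row.\<close>

definition box_number :: "diagram \<Rightarrow> nat \<times> nat \<Rightarrow> nat" where
  "box_number lam b = card {b' \<in> lam. fst b' < fst b \<or> fst b' = fst b \<and> snd b' \<le> snd b}"

definition row_perms :: "diagram \<Rightarrow> (nat \<Rightarrow> nat) set" where
  "row_perms lam = {s. s permutes {1..card lam} \<and>
     (\<forall>b\<in>lam. \<exists>b'\<in>lam. fst b' = fst b \<and> s (box_number lam b) = box_number lam b')}"

definition column_perms :: "diagram \<Rightarrow> (nat \<Rightarrow> nat) set" where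
  "column_perms lam = {s. s permutes {1..card lam} \<and>
     (\<forall>b\<in>lam. \<exists>b'\<in>lam. snd b' = snd b \<and> s (box_number lam b) = box_number lam b')}"

type_synonym group_ring = "(nat \<Rightarrow> nat) \<Rightarrow> complex"

definition young_symmetrizer :: "diagram \<Rightarrow> group_ring" where
  "young_symmetrizer lam = (\<lambda>s. \<Sum>p\<in>row_perms lam. \<Sum>q\<in>column_perms lam.
     if s = p \<circ> q then of_int (sign q) else 0)"

text \<open>Left multiplication by a permutation \<open>s\<close> in the group ring.\<close>

definition perm_mult :: "(nat \<Rightarrow> nat) \<Rightarrow> group_ring \<Rightarrow> group_ring" where
  "perm_mult s f = (\<lambda>p. f (inv_into UNIV s \<circ> p))"

text \<open>\<open>S(lam)\<close>, as the left ideal of the group ring generated by the Young symmetrizer.\<close>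

definition specht_module :: "diagram \<Rightarrow> group_ring set" where
  "specht_module lam =
     complex_space.span {perm_mult s (young_symmetrizer lam) |s. s permutes {1..card lam}}"


section \<open>The modules \<open>U(lam, N)\<close> and \<open>V(lam, n)\<close>\<close>

definition traceless_tensors :: "nat \<Rightarrow> nat \<Rightarrow> tensor set" where
  "traceless_tensors N m = {t \<in> tensors N m. \<forall>k\<in>{1..m}. \<forall>l\<in>{1..m}. k \<noteq> l \<longrightarrow>
     brauer_rep N m (brauer_basis (bar_graph m k l)) t = 0}"

definition perm_act :: "nat \<Rightarrow> nat \<Rightarrow> (nat \<Rightarrow> nat) \<Rightarrow> tensor \<Rightarrow> tensor" where
  "perm_act N m s = brauer_rep N m (brauer_basis (perm_graph m s))"

text \<open>By Schur's lemma, the factor \<open>U(lam, N)\<close> in the decomposition of the space of traceless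
  tensors into the \<open>U(lam, N) \<otimes> S(lam)\<close> is the multiplicity space of \<open>S(lam)\<close>, and the
  factor \<open>V(lam, n)\<close> in the decomposition of the \<open>n\<close>-th tensor power of \<open>U\<close> into the
  \<open>U(lam, N) \<otimes> V(lam, n)\<close> is the multiplicity space of \<open>U(lam, N)\<close>.  The group, respectively
  \<open>C(n, N)\<close>, acts on them by composition.\<close>

definition weyl_module :: "nat \<Rightarrow> diagram \<Rightarrow> (group_ring \<Rightarrow> tensor) set" where
  "weyl_module N lam =
     intertwiners {s. s permutes {1..card lam}} perm_mult (specht_module lam)
       (perm_act N (card lam)) (traceless_tensors N (card lam))"

definition weyl_act ::
  "nat \<Rightarrow> diagram \<Rightarrow> complex mat \<Rightarrow> (group_ring \<Rightarrow> tensor) \<Rightarrow> group_ring \<Rightarrow> tensor" where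
  "weyl_act N lam g u = tensor_act N (card lam) g \<circ> u"

type_synonym centralizer_vector = "(group_ring \<Rightarrow> tensor) \<Rightarrow> tensor"

definition centralizer_module :: "nat \<Rightarrow> nat \<Rightarrow> diagram \<Rightarrow> centralizer_vector set" where
  "centralizer_module N n lam =
     intertwiners (orthogonal_group N) (weyl_act N lam) (weyl_module N lam)
       (tensor_act N n) (tensors N n)"

definition centralizer_act :: "(tensor \<Rightarrow> tensor) \<Rightarrow> centralizer_vector \<Rightarrow> centralizer_vector" where
  "centralizer_act c v = c \<circ> v"

text \<open>\<open>V(lam, n)\<close> as a module over \<open>B(n, N)\<close>.\<close>

definition brauer_act :: "nat \<Rightarrow> nat \<Rightarrow> brauer \<Rightarrow> centralizer_vector \<Rightarrow> centralizer_vector" where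
  "brauer_act N n x = centralizer_act (brauer_rep N n x)"


section \<open>The canonical basis\<close>

definition differ_by_box :: "nat \<times> nat \<Rightarrow> diagram \<Rightarrow> diagram \<Rightarrow> bool" where
  "differ_by_box b \<mu> \<nu> \<longleftrightarrow> b \<notin> \<mu> \<and> \<nu> = insert b \<mu> \<or> b \<notin> \<nu> \<and> \<mu> = insert b \<nu>"

text \<open>A sequence \<open>\<Lambda>(1), \<dots>, \<Lambda>(n)\<close> is extended by the empty diagram, in
  particular \<open>\<Lambda>(0) = {}\<close>.\<close>

definition diagram_paths :: "nat \<Rightarrow> nat \<Rightarrow> diagram \<Rightarrow> (nat \<Rightarrow> diagram) set" where
  "diagram_paths N n lam = {\<Lambda>.
     (\<forall>k\<in>{1..n}. \<Lambda> k \<in> orthogonal_diagrams k N) \<and>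
     (\<forall>k. k \<notin> {1..n} \<longrightarrow> \<Lambda> k = {}) \<and>
     \<Lambda> n = lam \<and>
     (\<forall>k\<in>{1..<n}. \<exists>b. differ_by_box b (\<Lambda> k) (\<Lambda> (Suc k)))}"

text \<open>The component \<open>V(\<mu>, k)\<close> of the restriction of \<open>V(lam, n)\<close> to \<open>C(k, N)\<close>.\<close>

definition restriction_component ::
  "nat \<Rightarrow> nat \<Rightarrow> diagram \<Rightarrow> nat \<Rightarrow> diagram \<Rightarrow> centralizer_vector set" where
  "restriction_component N n lam k \<mu> =
     isotypic_component (centralizer_algebra N k)
       centralizer_act (centralizer_module N k \<mu>)
       (\<lambda>c. centralizer_act (centralizer_embed N k n c)) (centralizer_module N n lam)"

text \<open>\<open>v\<close> is a choice of the vector \<open>v(\<Lambda>)\<close>, which is unique up to a nonzero scalar.\<close>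

definition canonical_vector ::
  "nat \<Rightarrow> nat \<Rightarrow> diagram \<Rightarrow> (nat \<Rightarrow> diagram) \<Rightarrow> centralizer_vector \<Rightarrow> bool" where
  "canonical_vector N n lam \<Lambda> v \<longleftrightarrow> v \<in> centralizer_module N n lam \<and> v \<noteq> 0 \<and>
     (\<forall>k\<in>{1..<n}. v \<in> restriction_component N n lam k (\<Lambda> k))"

end

theory Submission
  imports Defs "Jordan_Normal_Form.Determinant" "HOL-Computational_Algebra.Polynomial"
begin

text \<open>
  The element \<open>Z(k) = x\<^sub>1 + \<dots> + x\<^sub>k\<close> acts by a scalar on every \<open>V(\<mu>, k)\<close>, namely by
  \<open>z(\<mu>) = |\<mu>| (N - 1) / 2 + \<Sum> (j - i)\<close>, where the sum runs over the boxes \<open>(i, j)\<close> of \<open>\<mu>\<close>.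
  Since \<open>v(\<Lambda>)\<close> lies in the components of type \<open>V(\<Lambda>(k), k)\<close> and \<open>V(\<Lambda>(k - 1), k - 1)\<close>, it is an
  eigenvector of \<open>x\<^sub>k = Z(k) - Z(k - 1)\<close> with eigenvalue \<open>z(\<Lambda>(k)) - z(\<Lambda>(k - 1))\<close>, which is
  \<open>(N - 1) / 2 + j - i\<close> if the box \<open>(i, j)\<close> is added, and minus this number if it is removed.

  To evaluate \<open>Z(n)\<close> on \<open>V(lam, n)\<close>, the space of \<open>G\<close>-maps from \<open>U(lam, N)\<close> to the \<open>n\<close>-th tensor
  power of \<open>U\<close>, let \<open>D(p, q)\<close> be the derivation of the tensor powers of \<open>U\<close> induced by the
  matrix \<open>E(p, q) - E(q, p)\<close>, where \<open>E(p, q)\<close> is a matrix unit.  A computation in coordinates shows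
  that the Casimir operator \<open>\<Sum> D(p, q)\<^sup>2\<close> equals \<open>-4 Z(n)\<close> on the \<open>n\<close>-th tensor power
  (\<open>casimir_eq\<close>).  So once \<open>v \<in> V(lam, n)\<close> is known to commute with the \<open>D(p, q)\<close>, it follows that
  \<open>Z(n) \<circ> v\<close> arises from \<open>v\<close> by applying \<open>Z(m)\<close> in the source, with \<open>m = |lam|\<close>.  By definition \<open>v\<close>
  commutes with the group only, but no limit is needed to pass to derivations: the
  matrix entries of the action of the rotation with rational parameter \<open>x\<close> are, up to a common
  power of \<open>1 + x\<^sup>2\<close>, polynomials in \<open>x\<close> of bounded degree, and the linear coefficient of
  such a polynomial is a fixed linear combination of finitely many of its values.  Hence \<open>D(p, q)\<close> is
  one and the same finite linear combination of group elements on all tensor powers up to a given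
  one (\<open>infinitesimal_rotation_eq_group_combination\<close>).

  The values of an element of \<open>U(lam, N)\<close> are traceless tensors, on which the contractions
  \<open>b(bar_graph m k l)\<close> act by \<open>0\<close>, so that \<open>Z(m)\<close> becomes \<open>m (N - 1) / 2\<close> plus the sum of all
  transpositions.  The latter acts on the left ideal \<open>S(lam)\<close> by \<open>\<Sum> (j - i)\<close>
  (\<open>transposition_sum_specht\<close>): it is central, and between the row symmetrizer \<open>a\<close> and the column
  antisymmetrizer \<open>b\<close> a transposition \<open>t\<close> gives \<open>a t b = a b\<close> if it exchanges two boxes of a row,
  \<open>a t b = - a b\<close> if it exchanges two boxes of a column, and \<open>a t b = 0\<close> otherwise.

  Finally, \<open>Z(k) \<in> B(k, N)\<close> acts by an element of \<open>C(k, N)\<close> whose image in \<open>C(n, N)\<close> is the action of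
  \<open>Z(k) \<in> B(n, N)\<close>, so its scalar on \<open>V(\<mu>, k)\<close> is inherited by the component of type \<open>V(\<mu>, k)\<close>
  in \<open>V(lam, n)\<close>.
\<close>

section \<open>Preliminaries\<close>

lemma sum_fun_apply: "(\<Sum>a\<in>A. f a) x = (\<Sum>a\<in>A. f a x)"
  for f :: "'a \<Rightarrow> 'b \<Rightarrow> 'c::comm_monoid_add"
  by (induction A rule: infinite_finite_induct) auto

lemma scaleC_apply: "(c *\<^sub>C f) x = c * f x" for f :: "'a \<Rightarrow> complex"
  by (simp add: scaleC_fun_def scaleC_complex_def)

lemma scaleC_fun_apply: "(c *\<^sub>C f) x = c *\<^sub>C f x"
  by (simp add: scaleC_fun_def)

lemma sum_if_const: "(\<Sum>x\<in>A. if P then f x else 0) = (if P then sum f A else 0)"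
  by simp

lemma sum_swap3:
  "(\<Sum>a\<in>A. \<Sum>b\<in>B. \<Sum>c\<in>C. f a b c) = (\<Sum>b\<in>B. \<Sum>c\<in>C. \<Sum>a\<in>A. f a b c)"
  by (rule trans[OF sum.swap]) (intro sum.cong refl sum.swap)

lemma sum_pairs_reindex:
  assumes s: "bij_betw s A B"
  shows "(\<Sum>a\<in>A. \<Sum>b\<in>A - {a}. F (s a) (s b)) = (\<Sum>a\<in>B. \<Sum>b\<in>B - {a}. F a b)"
proof -
  have "(\<Sum>b\<in>A - {a}. F (s a) (s b)) = (\<Sum>b\<in>B - {s a}. F (s a) b)" if "a \<in> A" for a
    using s that by (intro sum.reindex_bij_betw bij_betw_DiffI) (auto simp: bij_betw_def)
  then have "(\<Sum>a\<in>A. \<Sum>b\<in>A - {a}. F (s a) (s b)) = (\<Sum>a\<in>A. \<Sum>b\<in>B - {s a}. F (s a) b)"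
    by (simp cong: sum.cong)
  also have "\<dots> = (\<Sum>a\<in>B. \<Sum>b\<in>B - {a}. F a b)"
    by (rule sum.reindex_bij_betw[OF s])
  finally show ?thesis .
qed

text \<open>The function \<open>h\<close> assigns classes and \<open>r\<close> ranks the elements within a class.  Every unordered
  pair of elements of the same class is charged to its element of higher rank.\<close>

lemma sum_same_class:
  fixes h r :: "'a \<Rightarrow> nat"
  assumes fin: "finite A" and inj: "inj_on (\<lambda>x. (h x, r x)) A"
  shows "(\<Sum>x\<in>A. \<Sum>y\<in>A - {x}. if h x = h y then 1 else (0::complex)) =
    2 * (\<Sum>x\<in>A. of_nat (card {y \<in> A. h y = h x \<and> r y < r x}))"
proof -
  let ?f = "\<lambda>x y. if h y = h x \<and> r y < r x then 1 else (0::complex)"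
  have "(\<Sum>y\<in>A - {x}. if h x = h y then 1 else (0::complex)) = (\<Sum>y\<in>A. ?f x y + ?f y x)"
    if x: "x \<in> A" for x
  proof -
    have "(\<Sum>y\<in>A - {x}. if h x = h y then 1 else (0::complex)) = (\<Sum>y\<in>A - {x}. ?f x y + ?f y x)"
    proof (rule sum.cong)
      fix y assume "y \<in> A - {x}"
      then have "h x = h y \<Longrightarrow> r x < r y \<or> r y < r x"
        using inj x by (metis (lifting) Diff_iff inj_on_def insertI1 linorder_neq_iff)
      then show "(if h x = h y then 1 else (0::complex)) = ?f x y + ?f y x" by auto
    qed simp
    also have "\<dots> = (\<Sum>y\<in>A. ?f x y + ?f y x)"
      by (rule sum.mono_neutral_left) (use fin in auto)
    finally show ?thesis .
  qed
  then have "(\<Sum>x\<in>A. \<Sum>y\<in>A - {x}. if h x = h y then 1 else (0::complex)) =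
      (\<Sum>x\<in>A. \<Sum>y\<in>A. ?f x y) + (\<Sum>x\<in>A. \<Sum>y\<in>A. ?f y x)"
    by (simp add: sum.distrib)
  also have "(\<Sum>x\<in>A. \<Sum>y\<in>A. ?f y x) = (\<Sum>x\<in>A. \<Sum>y\<in>A. ?f x y)"
    by (rule sum.swap)
  finally show ?thesis
    using fin by (simp add: sum.If_cases Int_def)
qed

lemma sum_symmetric_pairs:
  fixes f :: "nat \<Rightarrow> nat \<Rightarrow> complex"
  assumes "\<And>a b. f a b = f b a"
  shows "(\<Sum>a\<in>{1..k}. \<Sum>b\<in>{1..k} - {a}. f a b) = 2 * (\<Sum>a\<in>{1..k}. \<Sum>b\<in>{1..<a}. f a b)"
proof (induction k)
  case (Suc k)
  have eq: "{1..Suc k} - {a} = insert (Suc k) ({1..k} - {a})" if "a \<in> {1..k}" for a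
    using that by auto
  have "(\<Sum>b\<in>{1..Suc k} - {a}. f a b) = f (Suc k) a + (\<Sum>b\<in>{1..k} - {a}. f a b)" if "a \<in> {1..k}" for a
    unfolding eq[OF that] using assms[of a "Suc k"] by simp
  moreover have "{1..Suc k} - {Suc k} = {1..k}" "{1..<Suc k} = {1..k}" by auto
  ultimately show ?case
    using Suc.IH by (simp add: sum.distrib cong: sum.cong_simp)
qed simp

section \<open>The sum of all transpositions on a Specht module\<close>

text \<open>The sum of the contents \<open>j - i\<close> of the boxes \<open>(i, j)\<close> of a diagram.\<close>

definition diagram_content :: "diagram \<Rightarrow> complex" where
  "diagram_content lam = (\<Sum>b\<in>lam. of_nat (snd b) - of_nat (fst b))"

lemma box_number_bij:
  assumes "finite lam"
  shows "bij_betw (box_number lam) lam {1..card lam}"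
proof -
  define S where "S b = {b' \<in> lam. fst b' < fst b \<or> fst b' = fst b \<and> snd b' \<le> snd b}" for b
  have B: "box_number lam b = card (S b)" for b by (simp add: box_number_def S_def)
  have fin: "finite (S b)" for b using assms by (simp add: S_def)
  have less: "card (S b) < card (S b')"
    if "b' \<in> lam" "fst b < fst b' \<or> fst b = fst b' \<and> snd b < snd b'" for b b'
    by (rule psubset_card_mono[OF fin]) (use that in \<open>auto simp: S_def\<close>)
  have inj: "inj_on (box_number lam) lam"
  proof (rule inj_onI)
    fix b b' assume "b \<in> lam" "b' \<in> lam" and eq: "box_number lam b = box_number lam b'"
    then show "b = b'"
      using less[of b b'] less[of b' b] unfolding B by (metis nat_neq_iff prod_eqI)
  qed
  have sub: "box_number lam ` lam \<subseteq> {1..card lam}"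
  proof
    fix x assume "x \<in> box_number lam ` lam"
    then obtain b where b: "b \<in> lam" "x = card (S b)" by (auto simp: B)
    have "b \<in> S b" using b by (simp add: S_def)
    then have "card (S b) > 0" using fin card_gt_0_iff by blast
    moreover have "card (S b) \<le> card lam" by (rule card_mono[OF assms]) (auto simp: S_def)
    ultimately show "x \<in> {1..card lam}" using b by simp
  qed
  have "box_number lam ` lam = {1..card lam}"
    by (rule card_subset_eq[OF _ sub]) (simp_all add: card_image[OF inj])
  then show ?thesis using inj by (simp add: bij_betw_def)
qed

lemma transpose_compose_perm:
  assumes "bij p"
  shows "transpose (p a) (p b) \<circ> p = p \<circ> transpose a b"
  using bij_is_inj[OF assms] by (auto simp: transpose_def inj_eq fun_eq_iff)

text \<open>The permutations of \<open>{1..card lam}\<close>, seen as the set of numbers of the boxes, that preserve the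
  value of \<open>h\<close> on the boxes: the row group for \<open>h = fst\<close> and the column group for \<open>h = snd\<close>.\<close>

definition class_perms :: "diagram \<Rightarrow> (nat \<times> nat \<Rightarrow> nat) \<Rightarrow> (nat \<Rightarrow> nat) set" where
  "class_perms lam h = {s. s permutes {1..card lam} \<and>
     (\<forall>b\<in>lam. \<exists>b'\<in>lam. h b' = h b \<and> s (box_number lam b) = box_number lam b')}"

lemma row_perms_eq: "row_perms lam = class_perms lam fst"
  and column_perms_eq: "column_perms lam = class_perms lam snd"
  by (simp_all add: row_perms_def column_perms_def class_perms_def)

lemma transpose_mem_class_perms:
  assumes "finite lam" "x \<in> lam" "y \<in> lam" "h x = h y"
  shows "transpose (box_number lam x) (box_number lam y) \<in> class_perms lam h"
proof -
  have mem: "box_number lam b \<in> {1..card lam}" if "b \<in> lam" for b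
    using bij_betwE[OF box_number_bij[OF assms(1)]] that by blast
  have "\<exists>b'\<in>lam. h b' = h b \<and>
      transpose (box_number lam x) (box_number lam y) (box_number lam b) = box_number lam b'"
    if "b \<in> lam" for b
  proof -
    have "box_number lam b = box_number lam c \<longleftrightarrow> b = c" if "c \<in> lam" for c
      using bij_betw_imp_inj_on[OF box_number_bij[OF assms(1)]] that \<open>b \<in> lam\<close>
      by (auto simp: inj_on_eq_iff)
    then show ?thesis
      using assms that by (cases "b = x"; cases "b = y") (auto simp: transpose_def)
  qed
  then show ?thesis
    using permutes_swap_id[OF mem[OF assms(2)] mem[OF assms(3)]]
    by (simp add: class_perms_def)
qed

lemma compose_mem_class_perms:
  assumes "p \<in> class_perms lam h" "q \<in> class_perms lam h"
  shows "p \<circ> q \<in> class_perms lam h"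
proof -
  have "\<exists>b'\<in>lam. h b' = h b \<and> p (q (box_number lam b)) = box_number lam b'" if b: "b \<in> lam" for b
  proof -
    obtain c where "c \<in> lam" "h c = h b" "q (box_number lam b) = box_number lam c"
      using assms(2) b unfolding class_perms_def by blast
    moreover from this obtain d where "d \<in> lam" "h d = h c" "p (box_number lam c) = box_number lam d"
      using assms(1) unfolding class_perms_def by blast
    ultimately show ?thesis by auto
  qed
  then show ?thesis
    using assms by (auto simp: class_perms_def intro!: permutes_compose)
qed

text \<open>The element \<open>a t b\<close> of the group ring, where \<open>a\<close> is the sum over the row group and \<open>b\<close> the
  signed sum over the column group, so that \<open>a b\<close> is the Young symmetrizer.\<close>

definition middle_symmetrizer :: "diagram \<Rightarrow> (nat \<Rightarrow> nat) \<Rightarrow> group_ring" where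
  "middle_symmetrizer lam t = (\<lambda>g. \<Sum>p\<in>row_perms lam. \<Sum>q\<in>column_perms lam.
     if g = p \<circ> t \<circ> q then of_int (sign q) else 0)"

lemma middle_symmetrizer_id: "middle_symmetrizer lam id = young_symmetrizer lam"
  by (simp add: middle_symmetrizer_def young_symmetrizer_def)

lemma middle_symmetrizer_row:
  assumes "finite lam" "x \<in> lam" "y \<in> lam" "fst x = fst y"
  shows "middle_symmetrizer lam (transpose (box_number lam x) (box_number lam y) \<circ> t) =
    middle_symmetrizer lam t"
proof
  fix g
  let ?r = "transpose (box_number lam x) (box_number lam y)"
  have r: "?r \<in> row_perms lam"
    unfolding row_perms_eq by (rule transpose_mem_class_perms) (use assms in auto)
  have mem: "p \<circ> ?r \<in> row_perms lam" if "p \<in> row_perms lam" for p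
    using compose_mem_class_perms that r unfolding row_perms_eq by blast
  have rr: "p \<circ> ?r \<circ> ?r = p" for p :: "nat \<Rightarrow> nat"
    by (simp add: comp_assoc)
  show "middle_symmetrizer lam (?r \<circ> t) g = middle_symmetrizer lam t g"
    unfolding middle_symmetrizer_def
    by (rule sum.reindex_bij_witness[where i = "\<lambda>p. p \<circ> ?r" and j = "\<lambda>p. p \<circ> ?r"])
      (use mem rr in \<open>auto simp: comp_assoc\<close>)
qed

lemma middle_symmetrizer_column:
  assumes "finite lam" "x \<in> lam" "y \<in> lam" "snd x = snd y" "x \<noteq> y"
  shows "middle_symmetrizer lam (t \<circ> transpose (box_number lam x) (box_number lam y)) =
    - middle_symmetrizer lam t"
proof
  fix g :: "nat \<Rightarrow> nat"
  let ?c = "transpose (box_number lam x) (box_number lam y)"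
  have c: "?c \<in> column_perms lam"
    unfolding column_perms_eq by (rule transpose_mem_class_perms) (use assms in auto)
  have mem: "?c \<circ> q \<in> column_perms lam" if "q \<in> column_perms lam" for q
    using compose_mem_class_perms that c unfolding column_perms_eq by blast
  have cc: "?c \<circ> (?c \<circ> q) = q" for q :: "nat \<Rightarrow> nat"
    by (simp add: comp_assoc[symmetric])
  have ne: "box_number lam x \<noteq> box_number lam y"
    using bij_betw_imp_inj_on[OF box_number_bij[OF assms(1)]] assms
    by (auto simp: inj_on_eq_iff)
  have sign: "sign (?c \<circ> q) = - sign q" if "q \<in> column_perms lam" for q
  proof -
    have "permutation q"
      using that permutes_imp_permutation[of "{1..card lam}" q] by (auto simp: column_perms_def)
    then show ?thesis using ne by (simp add: sign_compose permutation_swap_id sign_swap_id)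
  qed
  have "(\<Sum>q\<in>column_perms lam. if g = p \<circ> (t \<circ> ?c) \<circ> q then of_int (sign q) else 0) =
      (\<Sum>q\<in>column_perms lam. - (if g = p \<circ> t \<circ> q then of_int (sign q) else 0 :: complex))" for p
    by (rule sum.reindex_bij_witness[where i = "\<lambda>q. ?c \<circ> q" and j = "\<lambda>q. ?c \<circ> q"])
      (use mem cc sign in \<open>auto simp: comp_assoc\<close>)
  then show "middle_symmetrizer lam (t \<circ> ?c) g = (- middle_symmetrizer lam t) g"
    by (simp add: middle_symmetrizer_def sum_negf)
qed

lemma middle_symmetrizer_transpose:
  assumes lam: "young_diagram lam" and xy: "x \<in> lam" "y \<in> lam" "x \<noteq> y"
  shows "middle_symmetrizer lam (transpose (box_number lam x) (box_number lam y)) =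
    ((if fst x = fst y then 1 else 0) - (if snd x = snd y then 1 else 0)) *\<^sub>C young_symmetrizer lam"
proof -
  have fin: "finite lam" using lam by (simp add: young_diagram_def)
  let ?B = "box_number lam" and ?E = "middle_symmetrizer lam"
  have inj: "?B a = ?B b \<longleftrightarrow> a = b" if "a \<in> lam" "b \<in> lam" for a b
    using bij_betw_imp_inj_on[OF box_number_bij[OF fin]] that by (auto simp: inj_on_eq_iff)
  have zero: "?E (transpose (?B x) (?B y)) = 0"
    if xy: "x \<in> lam" "y \<in> lam" "fst x < fst y" "snd x \<noteq> snd y" for x y
  proof -
    \<comment> \<open>The transposition \<open>t\<close> of \<open>x\<close> and \<open>y\<close> satisfies \<open>r t = t c\<close>, where \<open>r\<close> exchanges \<open>x\<close> with the
      box \<open>z\<close> in its row and \<open>c\<close> exchanges \<open>z\<close> with the box \<open>y\<close> in its column.  Hence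
      \<open>a t b = a r t b = a t c b = - a t b\<close>.\<close>
    define z where "z = (fst x, snd y)"
    let ?t = "transpose (?B x) (?B y)"
    have z: "z \<in> lam"
    proof -
      have "(fst x, snd x) \<in> lam" "(fst y, snd y) \<in> lam" using xy by simp_all
      moreover have "fst x \<in> {1..fst y}" "snd y \<in> {1..snd y}"
        using lam xy unfolding young_diagram_def by fastforce+
      ultimately show ?thesis
        using lam unfolding young_diagram_def z_def by blast
    qed
    have ne: "z \<noteq> x" "z \<noteq> y" using xy by (auto simp: z_def prod_eq_iff)
    then have "transpose (?B x) (?B z) \<circ> ?t = ?t \<circ> transpose (?B z) (?B y)"
      using inj[OF z xy(1)] inj[OF z xy(2)] inj[OF xy(1) xy(2)] xy
      by (auto simp: fun_eq_iff transpose_def)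
    then have "?E ?t = ?E (?t \<circ> transpose (?B z) (?B y))"
      using middle_symmetrizer_row[OF fin xy(1) z, of ?t] by (simp add: z_def)
    also have "\<dots> = - ?E ?t"
      by (rule middle_symmetrizer_column[OF fin z xy(2)]) (use ne in \<open>auto simp: z_def\<close>)
    finally show ?thesis
      by (auto simp: fun_eq_iff)
  qed
  consider "fst x = fst y" | "snd x = snd y" | "fst x < fst y" "snd x \<noteq> snd y"
    | "fst y < fst x" "snd x \<noteq> snd y" by linarith
  then show ?thesis
  proof cases
    case 1
    then show ?thesis
      using middle_symmetrizer_row[OF fin xy(1,2), of id] xy(3)
      by (auto simp: middle_symmetrizer_id prod_eq_iff scaleC_one)
  next
    case 2
    then show ?thesis
      using middle_symmetrizer_column[OF fin xy(1,2) _ xy(3), of id] xy(3)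
      by (auto simp: middle_symmetrizer_id prod_eq_iff scaleC_apply fun_eq_iff)
  next
    case 3
    then show ?thesis using zero[of x y] xy by simp
  next
    case 4
    then show ?thesis using zero[of y x] xy by (simp add: transpose_commute)
  qed
qed

lemma sum_same_row_column:
  assumes lam: "young_diagram lam"
  shows "(\<Sum>x\<in>lam. \<Sum>y\<in>lam - {x}.
      (if fst x = fst y then 1 else 0) - (if snd x = snd y then 1 else 0)) = 2 * diagram_content lam"
proof -
  have fin: "finite lam" using lam by (simp add: young_diagram_def)
  have closed: "(i', j') \<in> lam" if "(i, j) \<in> lam" "i' \<in> {1..i}" "j' \<in> {1..j}" for i j i' j'
    using lam that unfolding young_diagram_def by blast
  have pos: "i \<ge> 1" "j \<ge> 1" if "(i, j) \<in> lam" for i j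
    using lam that unfolding young_diagram_def by auto
  have "{y \<in> lam. fst y = i \<and> snd y < j} = Pair i ` {1..<j}" if "(i, j) \<in> lam" for i j
    using closed[OF that, of i] pos pos[OF that] by (auto simp: image_iff)
  then have row: "of_nat (card {y \<in> lam. fst y = i \<and> snd y < j}) = (of_nat j - 1 :: complex)"
    if "(i, j) \<in> lam" for i j
    using that pos[OF that] by (simp add: card_image inj_on_def of_nat_diff)
  have "{y \<in> lam. snd y = j \<and> fst y < i} = (\<lambda>i'. (i', j)) ` {1..<i}" if "(i, j) \<in> lam" for i j
    using closed[OF that, of _ j] pos pos[OF that] by (auto simp: image_iff)
  then have col: "of_nat (card {y \<in> lam. snd y = j \<and> fst y < i}) = (of_nat i - 1 :: complex)"
    if "(i, j) \<in> lam" for i j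
    using that pos[OF that] by (simp add: card_image inj_on_def of_nat_diff)
  have "(\<Sum>x\<in>lam. \<Sum>y\<in>lam - {x}.
      (if fst x = fst y then 1 else 0) - (if snd x = snd y then 1 else 0 :: complex)) =
      2 * (\<Sum>x\<in>lam. of_nat (card {y \<in> lam. fst y = fst x \<and> snd y < snd x})) -
      2 * (\<Sum>x\<in>lam. of_nat (card {y \<in> lam. snd y = snd x \<and> fst y < fst x}))"
    using sum_same_class[OF fin, of fst snd] sum_same_class[OF fin, of snd fst]
    by (simp add: sum_subtractf inj_on_def prod_eq_iff)
  also have "\<dots> = 2 * (\<Sum>x\<in>lam. of_nat (snd x) - 1) - 2 * (\<Sum>x\<in>lam. of_nat (fst x) - 1)"
    using row col by (simp cong: sum.cong)
  finally show ?thesis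
    by (simp add: diagram_content_def sum_subtractf algebra_simps)
qed

text \<open>Left multiplication by twice the sum of all transpositions in \<open>S(m)\<close>; each of them occurs for
  two ordered pairs.\<close>

definition transposition_sum :: "nat \<Rightarrow> group_ring \<Rightarrow> group_ring" where
  "transposition_sum m f = (\<Sum>a\<in>{1..m}. \<Sum>b\<in>{1..m} - {a}. perm_mult (transpose a b) f)"

lemma perm_mult_compose:
  assumes "bij s" "bij t"
  shows "perm_mult (s \<circ> t) f = perm_mult s (perm_mult t f)"
  using assms by (simp add: perm_mult_def o_inv_distrib comp_assoc)

lemma perm_mult_add: "perm_mult s (f + g) = perm_mult s f + perm_mult s g"
  and perm_mult_scaleC: "perm_mult s (c *\<^sub>C f) = c *\<^sub>C perm_mult s f"
  by (simp_all add: perm_mult_def fun_eq_iff scaleC_apply)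

text \<open>The sum of all transpositions is central in the group ring of \<open>S(m)\<close>.\<close>

lemma transposition_sum_perm_mult:
  assumes s: "s permutes {1..m}"
  shows "transposition_sum m (perm_mult s f) = perm_mult s (transposition_sum m f)"
proof -
  have bij: "bij s" using s by (rule permutes_bij)
  have "perm_mult (transpose (s a) (s b)) (perm_mult s f) = perm_mult s (perm_mult (transpose a b) f)"
    for a b
    using transpose_compose_perm[OF bij, of a b] perm_mult_compose[OF bij, of "transpose a b" f]
      perm_mult_compose[OF _ bij, of "transpose (s a) (s b)" f] by simp
  then have "transposition_sum m (perm_mult s f) =
      (\<Sum>a\<in>{1..m}. \<Sum>b\<in>{1..m} - {a}. perm_mult s (perm_mult (transpose a b) f))"
    unfolding transposition_sum_def
    using sum_pairs_reindex[OF permutes_imp_bij[OF s], of "\<lambda>a b. perm_mult (transpose a b) (perm_mult s f)"]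
    by simp
  also have "\<dots> = perm_mult s (transposition_sum m f)"
    by (simp add: transposition_sum_def fun_eq_iff sum_fun_apply perm_mult_def)
  finally show ?thesis .
qed

lemma transposition_sum_young_symmetrizer:
  assumes lam: "young_diagram lam"
  shows "transposition_sum (card lam) (young_symmetrizer lam) =
    (2 * diagram_content lam) *\<^sub>C young_symmetrizer lam"
proof -
  let ?m = "card lam" and ?B = "box_number lam"
  have fin: "finite lam" using lam by (simp add: young_diagram_def)
  let ?S = "\<lambda>p q t g. if g = p \<circ> t \<circ> q then of_int (sign q) else (0::complex)"
  have mult: "perm_mult (transpose a b) (young_symmetrizer lam) g =
      (\<Sum>p\<in>row_perms lam. \<Sum>q\<in>column_perms lam.
        if g = transpose a b \<circ> p \<circ> q then of_int (sign q) else 0)" for a b g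
  proof -
    have "transpose a b \<circ> g = p \<circ> q \<longleftrightarrow> g = transpose a b \<circ> p \<circ> q" for p q :: "nat \<Rightarrow> nat"
      by (metis comp_assoc comp_id id_comp transpose_comp_involutory)
    then show ?thesis by (simp add: perm_mult_def young_symmetrizer_def)
  qed
  have "transposition_sum ?m (young_symmetrizer lam) g =
      (\<Sum>a\<in>{1..?m}. \<Sum>b\<in>{1..?m} - {a}. middle_symmetrizer lam (transpose a b) g)" for g
  proof -
    \<comment> \<open>Summed over all pairs, the transposition may be moved from the left of \<open>p\<close> to its right.\<close>
    have conj: "(\<Sum>a\<in>{1..?m}. \<Sum>b\<in>{1..?m} - {a}.
          if g = transpose a b \<circ> p \<circ> q then of_int (sign q) else (0::complex)) =
        (\<Sum>a\<in>{1..?m}. \<Sum>b\<in>{1..?m} - {a}. ?S p q (transpose a b) g)"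
      if "p \<in> row_perms lam" for p q
    proof -
      have p: "p permutes {1..?m}" using that by (simp add: row_perms_def)
      show ?thesis
        using sum_pairs_reindex[OF permutes_imp_bij[OF p],
            of "\<lambda>a b. if g = transpose a b \<circ> p \<circ> q then of_int (sign q) else (0::complex)"]
        by (simp add: transpose_compose_perm[OF permutes_bij[OF p]])
    qed
    have "transposition_sum ?m (young_symmetrizer lam) g =
        (\<Sum>a\<in>{1..?m}. \<Sum>b\<in>{1..?m} - {a}. \<Sum>p\<in>row_perms lam. \<Sum>q\<in>column_perms lam.
          if g = transpose a b \<circ> p \<circ> q then of_int (sign q) else 0)"
      by (simp add: transposition_sum_def sum_fun_apply mult)
    also have "\<dots> = (\<Sum>p\<in>row_perms lam. \<Sum>q\<in>column_perms lam. \<Sum>a\<in>{1..?m}. \<Sum>b\<in>{1..?m} - {a}.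
          if g = transpose a b \<circ> p \<circ> q then of_int (sign q) else 0)"
      by (simp only: sum_swap3[where B = "row_perms lam" and C = "column_perms lam"])
    also have "\<dots> = (\<Sum>p\<in>row_perms lam. \<Sum>q\<in>column_perms lam. \<Sum>a\<in>{1..?m}. \<Sum>b\<in>{1..?m} - {a}.
          ?S p q (transpose a b) g)"
      by (intro sum.cong refl conj)
    also have "\<dots> = (\<Sum>a\<in>{1..?m}. \<Sum>b\<in>{1..?m} - {a}. \<Sum>p\<in>row_perms lam. \<Sum>q\<in>column_perms lam.
          ?S p q (transpose a b) g)"
      by (simp only: sum_swap3[where B = "row_perms lam" and C = "column_perms lam"])
    finally show ?thesis by (simp add: middle_symmetrizer_def)
  qed
  also have "(\<Sum>a\<in>{1..?m}. \<Sum>b\<in>{1..?m} - {a}. middle_symmetrizer lam (transpose a b) g) =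
      (\<Sum>x\<in>lam. \<Sum>y\<in>lam - {x}. middle_symmetrizer lam (transpose (?B x) (?B y)) g)" for g
    by (rule sum_pairs_reindex[OF box_number_bij[OF fin], symmetric])
  also have "\<dots> g = (\<Sum>x\<in>lam. \<Sum>y\<in>lam - {x}.
      ((if fst x = fst y then 1 else 0) - (if snd x = snd y then 1 else 0)) * young_symmetrizer lam g)" for g
    by (intro sum.cong refl, subst middle_symmetrizer_transpose[OF lam]) (auto simp: scaleC_apply)
  also have "\<dots> g = 2 * diagram_content lam * young_symmetrizer lam g" for g
    unfolding sum_distrib_right[symmetric] sum_same_row_column[OF lam] ..
  finally show ?thesis by (simp add: fun_eq_iff scaleC_apply)
qed

lemma transposition_sum_specht:
  assumes lam: "young_diagram lam" and f: "f \<in> specht_module lam"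
  shows "transposition_sum (card lam) f = (2 * diagram_content lam) *\<^sub>C f"
proof -
  let ?X = "{perm_mult s (young_symmetrizer lam) |s. s permutes {1..card lam}}"
  have "complex_space.subspace {f. transposition_sum (card lam) f = (2 * diagram_content lam) *\<^sub>C f}"
  proof (rule complex_space.subspaceI)
    show "0 \<in> {f. transposition_sum (card lam) f = (2 * diagram_content lam) *\<^sub>C f}"
      by (simp add: fun_eq_iff scaleC_apply transposition_sum_def sum_fun_apply perm_mult_def)
  qed (simp_all add: fun_eq_iff scaleC_apply transposition_sum_def sum_fun_apply perm_mult_def
      sum.distrib distrib_left sum_distrib_left[symmetric])
  moreover have "?X \<subseteq> {f. transposition_sum (card lam) f = (2 * diagram_content lam) *\<^sub>C f}"
    by (auto simp: transposition_sum_perm_mult transposition_sum_young_symmetrizer[OF lam]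
        perm_mult_scaleC)
  ultimately show ?thesis
    using f complex_space.span_minimal unfolding specht_module_def by blast
qed

lemma perm_mult_specht:
  assumes s: "s permutes {1..card lam}" and f: "f \<in> specht_module lam"
  shows "perm_mult s f \<in> specht_module lam"
proof -
  let ?X = "{perm_mult s (young_symmetrizer lam) |s. s permutes {1..card lam}}"
  have "complex_space.subspace {f. perm_mult s f \<in> specht_module lam}"
  proof (rule complex_space.subspaceI)
    have "perm_mult s 0 = 0" by (simp add: perm_mult_def fun_eq_iff)
    then show "0 \<in> {f. perm_mult s f \<in> specht_module lam}"
      by (simp add: specht_module_def complex_space.span_zero)
  qed (simp_all add: specht_module_def perm_mult_add perm_mult_scaleC
      complex_space.span_add complex_space.span_scale)
  moreover have "?X \<subseteq> {f. perm_mult s f \<in> specht_module lam}"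
  proof clarify
    fix t assume t: "t permutes {1..card lam}"
    have "perm_mult s (perm_mult t (young_symmetrizer lam)) = perm_mult (s \<circ> t) (young_symmetrizer lam)"
      by (simp add: perm_mult_compose permutes_bij[OF s] permutes_bij[OF t])
    then show "perm_mult s (perm_mult t (young_symmetrizer lam)) \<in> specht_module lam"
      using permutes_compose[OF t s] unfolding specht_module_def
      by (intro complex_space.span_base) auto
  qed
  ultimately show ?thesis
    using f complex_space.span_minimal unfolding specht_module_def by blast
qed

section \<open>The action of the Brauer algebra in coordinates\<close>

lemma subspace_tensors: "complex_space.subspace (tensors N n)"
  by (rule complex_space.subspaceI) (auto simp: tensors_def scaleC_apply)

lemma tensors_0 [simp]: "0 \<in> tensors N n"
  by (simp add: tensors_def)

lemma multi_indices_upd: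
  "i \<in> multi_indices N n \<Longrightarrow> a \<in> {1..n} \<Longrightarrow> c < N \<Longrightarrow> i(a := c) \<in> multi_indices N n"
  by (auto simp: multi_indices_def PiE_iff extensional_def)

lemma multi_indices_less: "i \<in> multi_indices N n \<Longrightarrow> a \<in> {1..n} \<Longrightarrow> i a < N"
  by (auto simp: multi_indices_def PiE_iff)

lemma multi_indices_eqI:
  assumes "i \<in> multi_indices N n" "j \<in> multi_indices N n" "\<And>a. a \<in> {1..n} \<Longrightarrow> i a = j a"
  shows "i = j"
  using assms unfolding multi_indices_def by (intro PiE_ext[of i "{1..n}" _ j]) auto

lemma multi_indices_compose_iff:
  assumes s: "s permutes {1..n}"
  shows "i \<circ> s \<in> multi_indices N n \<longleftrightarrow> i \<in> multi_indices N n"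
proof -
  have "i \<circ> s \<in> multi_indices N n" if "i \<in> multi_indices N n" "s permutes {1..n}" for i s
    using that permutes_in_image[OF that(2)] permutes_not_in[OF that(2)]
    by (auto simp: multi_indices_def PiE_iff extensional_def)
  from this[of _ s] this[of _ "inv_into UNIV s"] show ?thesis
    using s permutes_inv[OF s] permutes_inv_o[OF s] by (metis comp_assoc comp_id)
qed

lemma graph_act_perm:
  assumes s: "s permutes {1..n}" and t: "t \<in> tensors N n"
  shows "graph_act N n (perm_graph n s) t = (\<lambda>i. t (i \<circ> s))"
proof
  fix i
  show "graph_act N n (perm_graph n s) t i = t (i \<circ> s)"
  proof (cases "i \<in> multi_indices N n")
    case True
    then have mem: "i \<circ> s \<in> multi_indices N n" using multi_indices_compose_iff[OF s] by simp
    have "constant_on_edges (vertex_label i j) (perm_graph n s) \<longleftrightarrow> j = i \<circ> s"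
      if j: "j \<in> multi_indices N n" for j
    proof -
      have "constant_on_edges (vertex_label i j) (perm_graph n s) \<longleftrightarrow> (\<forall>m\<in>{1..n}. i (s m) = j m)"
        unfolding perm_graph_def Setcompr_eq_image by (auto simp: constant_on_edges_def)
      also have "\<dots> \<longleftrightarrow> j = i \<circ> s"
        using multi_indices_eqI[OF j mem] by auto
      finally show ?thesis .
    qed
    then have "graph_act N n (perm_graph n s) t i =
        (\<Sum>j\<in>multi_indices N n. if j = i \<circ> s then t j else 0)"
      using True by (simp add: graph_act_def cong: sum.cong_simp)
    then show ?thesis using mem by (simp add: finite_multi_indices)
  next
    case False
    then show ?thesis
      using t multi_indices_compose_iff[OF s] by (simp add: graph_act_def tensors_def)
  qed
qed

lemma constant_on_bar_graph:
  assumes "k \<in> {1..n}" "l \<in> {1..n}" "k \<noteq> l"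
  shows "constant_on_edges (vertex_label i j) (bar_graph n k l) \<longleftrightarrow>
    i k = i l \<and> j k = j l \<and> (\<forall>m\<in>{1..n} - {k, l}. i m = j m)"
  unfolding bar_graph_def Setcompr_eq_image ball_Un constant_on_edges_def by auto

lemma graph_act_bar:
  assumes kl: "k \<in> {1..n}" "l \<in> {1..n}" "k \<noteq> l" and i: "i \<in> multi_indices N n"
  shows "graph_act N n (bar_graph n k l) t i =
    (if i k = i l then \<Sum>c<N. t (i(k := c, l := c)) else 0)"
proof (cases "i k = i l")
  case True
  have inj: "inj_on (\<lambda>c. i(k := c, l := c)) {..<N}"
    by (rule inj_onI) (metis fun_upd_same)
  have set: "{j \<in> multi_indices N n. j k = j l \<and> (\<forall>m\<in>{1..n} - {k, l}. i m = j m)} =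
      (\<lambda>c. i(k := c, l := c)) ` {..<N}"
  proof (intro equalityI subsetI)
    fix j assume j: "j \<in> {j \<in> multi_indices N n. j k = j l \<and> (\<forall>m\<in>{1..n} - {k, l}. i m = j m)}"
    then have "j = i(k := j k, l := j k)"
      using kl i by (intro multi_indices_eqI[of j N n]) (auto simp: multi_indices_upd multi_indices_less)
    then show "j \<in> (\<lambda>c. i(k := c, l := c)) ` {..<N}"
      using j kl multi_indices_less by blast
  qed (use kl i in \<open>auto simp: multi_indices_upd split: if_splits\<close>)
  have "graph_act N n (bar_graph n k l) t i =
      (\<Sum>j\<in>multi_indices N n. if j k = j l \<and> (\<forall>m\<in>{1..n} - {k, l}. i m = j m) then t j else 0)"
    using True i by (simp add: graph_act_def constant_on_bar_graph[OF kl])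
  also have "\<dots> = (\<Sum>j\<in>(\<lambda>c. i(k := c, l := c)) ` {..<N}. t j)"
    unfolding set[symmetric] by (simp add: sum.If_cases finite_multi_indices Int_def)
  also have "\<dots> = (\<Sum>c<N. t (i(k := c, l := c)))"
    by (simp add: sum.reindex[OF inj])
  finally show ?thesis using True by simp
next
  case False
  then show ?thesis by (simp add: graph_act_def constant_on_bar_graph[OF kl])
qed

text \<open>The action of the transposition \<open>(k, l)\<close> minus that of \<open>b(bar_graph n k l)\<close>, in coordinates.\<close>

definition swap_minus_contract :: "nat \<Rightarrow> nat \<Rightarrow> nat \<Rightarrow> tensor \<Rightarrow> tensor" where
  "swap_minus_contract N k l t = (\<lambda>i. t (i \<circ> transpose k l) -
     (if i k = i l then \<Sum>c<N. t (i(k := c, l := c)) else 0))"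

lemma swap_minus_contract_commute: "swap_minus_contract N k l = swap_minus_contract N l k"
proof (intro ext)
  fix t :: tensor and i :: "nat \<Rightarrow> nat"
  have "i(k := c, l := c) = i(l := c, k := c)" for c by auto
  then show "swap_minus_contract N k l t i = swap_minus_contract N l k t i"
    unfolding swap_minus_contract_def transpose_commute[of k l] by (simp add: eq_commute)
qed

lemma brauer_rep_add: "brauer_rep N n (x + y) t = brauer_rep N n x t + brauer_rep N n y t"
  by (simp add: brauer_rep_def scaleC_add_left sum.distrib)

lemma brauer_rep_scaleC: "brauer_rep N n (c *\<^sub>C x) t = c *\<^sub>C brauer_rep N n x t"
  by (simp add: brauer_rep_def scaleC_apply complex_space.scale_sum_right scaleC_scaleC)

lemma brauer_rep_0: "brauer_rep N n 0 t = 0"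
  by (simp add: brauer_rep_def)

lemma brauer_rep_diff: "brauer_rep N n (x - y) t = brauer_rep N n x t - brauer_rep N n y t"
  by (simp add: brauer_rep_def complex_space.scale_left_diff_distrib sum_subtractf)

lemma brauer_rep_sum: "brauer_rep N n (\<Sum>a\<in>A. x a) t = (\<Sum>a\<in>A. brauer_rep N n (x a) t)"
proof (induction A rule: infinite_finite_induct)
  case (insert a A)
  then show ?case unfolding sum.insert[OF insert.hyps] brauer_rep_add by simp
next
  case (infinite A)
  show ?case unfolding sum.infinite[OF infinite.hyps] by (rule brauer_rep_0)
qed (unfold sum.empty, rule brauer_rep_0)

lemma graph_act_add: "graph_act N n \<gamma> (t + t') = graph_act N n \<gamma> t + graph_act N n \<gamma> t'"
  and graph_act_scaleC: "graph_act N n \<gamma> (c *\<^sub>C t) = c *\<^sub>C graph_act N n \<gamma> t"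
  by (auto simp: graph_act_def fun_eq_iff scaleC_apply sum.distrib[symmetric] sum_distrib_left intro!: sum.cong)

lemma brauer_rep_mem: "brauer_rep N n x t \<in> tensors N n"
  unfolding brauer_rep_def using subspace_tensors[of N n]
  by (auto intro!: complex_space.subspace_sum complex_space.subspace_scale graph_act_mem)

lemma brauer_rep_add_right:
  assumes "t \<in> tensors N n" "t' \<in> tensors N n"
  shows "brauer_rep N n x (t + t') = brauer_rep N n x t + brauer_rep N n x t'"
  using assms complex_space.subspace_add[OF subspace_tensors assms]
  by (simp add: brauer_rep_def graph_act_add scaleC_add_right sum.distrib)

lemma brauer_rep_scaleC_right:
  assumes "t \<in> tensors N n"
  shows "brauer_rep N n x (c *\<^sub>C t) = c *\<^sub>C brauer_rep N n x t"
  using assms complex_space.subspace_scale[OF subspace_tensors assms]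
  by (simp add: brauer_rep_def graph_act_scaleC complex_space.scale_sum_right scaleC_scaleC mult.commute)

lemma brauer_rep_outside: "t \<notin> tensors N n \<Longrightarrow> brauer_rep N n x t = 0"
  by (simp add: brauer_rep_def)

lemma brauer_rep_0_right: "brauer_rep N n x 0 = 0"
  using brauer_rep_scaleC_right[OF tensors_0, of N n x 0]
  unfolding complex_space.scale_zero_left .

lemma brauer_rep_jucys_murphy:
  assumes k: "k \<in> {1..n}" and t: "t \<in> tensors N n" and i: "i \<in> multi_indices N n"
  shows "brauer_rep N n (jucys_murphy N n k) t i =
    (of_nat N - 1) / 2 * t i + (\<Sum>l\<in>{1..<k}. swap_minus_contract N k l t i)"
proof -
  have "brauer_rep N n (brauer_basis (perm_graph n (transpose k l)) - brauer_basis (bar_graph n k l)) t i =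
      swap_minus_contract N k l t i" if l: "l \<in> {1..<k}" for l
  proof -
    have l': "l \<in> {1..n}" "k \<noteq> l" using l k by auto
    show ?thesis
      using graph_act_perm[OF permutes_swap_id[OF k l'(1)] t] graph_act_bar[OF k l' i]
      by (simp add: brauer_rep_diff brauer_rep_basis[OF perm_graph_mem[OF permutes_swap_id[OF k l'(1)]] t]
          brauer_rep_basis[OF bar_graph_mem[OF k l'] t] swap_minus_contract_def)
  qed
  then show ?thesis
    by (simp add: jucys_murphy_def brauer_rep_add brauer_rep_scaleC brauer_rep_sum sum_fun_apply scaleC_apply
        brauer_rep_basis[OF perm_graph_mem[OF permutes_id] t] graph_act_perm[OF permutes_id t]
        cong: sum.cong_simp)
qed

text \<open>The element \<open>x\<^sub>1 + \<dots> + x\<^sub>k\<close> of \<open>B(n, N)\<close>.\<close>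

definition jucys_murphy_sum :: "nat \<Rightarrow> nat \<Rightarrow> nat \<Rightarrow> brauer" where
  "jucys_murphy_sum N n k = (\<Sum>m\<in>{1..k}. jucys_murphy N n m)"

lemma brauer_rep_jucys_murphy_sum:
  assumes k: "k \<le> n" and t: "t \<in> tensors N n" and i: "i \<in> multi_indices N n"
  shows "brauer_rep N n (jucys_murphy_sum N n k) t i =
    of_nat k * (of_nat N - 1) / 2 * t i +
    1 / 2 * (\<Sum>a\<in>{1..k}. \<Sum>b\<in>{1..k} - {a}. swap_minus_contract N a b t i)"
proof -
  have "brauer_rep N n (jucys_murphy_sum N n k) t i = (\<Sum>m\<in>{1..k}. brauer_rep N n (jucys_murphy N n m) t i)"
    by (simp add: jucys_murphy_sum_def brauer_rep_sum sum_fun_apply)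
  also have "\<dots> = (\<Sum>m\<in>{1..k}. (of_nat N - 1) / 2 * t i + (\<Sum>l\<in>{1..<m}. swap_minus_contract N m l t i))"
    by (rule sum.cong) (use k in \<open>auto simp: brauer_rep_jucys_murphy[OF _ t i]\<close>)
  also have "\<dots> = of_nat k * (of_nat N - 1) / 2 * t i + (\<Sum>m\<in>{1..k}. \<Sum>l\<in>{1..<m}. swap_minus_contract N m l t i)"
    by (simp add: sum.distrib)
  finally show ?thesis
    using sum_symmetric_pairs[of "\<lambda>a b. swap_minus_contract N a b t i" k,
        OF fun_cong[OF fun_cong[OF swap_minus_contract_commute]]]
    by simp
qed

section \<open>The Casimir operator of the orthogonal Lie algebra\<close>

text \<open>The matrix \<open>E(p, q) - E(q, p)\<close>, an element of the orthogonal Lie algebra, applied to the \<open>a\<close>-th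
  tensor factor.\<close>

definition slot_rotation :: "nat \<Rightarrow> nat \<Rightarrow> nat \<Rightarrow> tensor \<Rightarrow> tensor" where
  "slot_rotation a p q t = (\<lambda>i.
     (if i a = p then t (i(a := q)) else 0) - (if i a = q then t (i(a := p)) else 0))"

text \<open>The derivation of the \<open>n\<close>-th tensor power by which \<open>E(p, q) - E(q, p)\<close> acts as an element of
  the Lie algebra.\<close>

definition infinitesimal_rotation :: "nat \<Rightarrow> nat \<Rightarrow> nat \<Rightarrow> nat \<Rightarrow> tensor \<Rightarrow> tensor" where
  "infinitesimal_rotation N n p q t = (\<lambda>i. if i \<in> multi_indices N n
     then \<Sum>a\<in>{1..n}. slot_rotation a p q t i else 0)"

lemma sum_slot_rotation_diagonal:
  assumes a: "i a < N"
  shows "(\<Sum>p<N. \<Sum>q<N. slot_rotation a p q (slot_rotation a p q t) i) = -2 * (of_nat N - 1) * t i"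
proof -
  have eq: "slot_rotation a p q (slot_rotation a p q t) i =
      (if q = i a then if p = i a then 2 * t i else 0 else 0) -
      (if p = i a then t i else 0) - (if q = i a then t i else 0)" for p q
    by (auto simp: slot_rotation_def)
  show ?thesis
    unfolding eq using a by (simp add: sum.distrib sum_subtractf sum_if_const sum_distrib_left[symmetric] algebra_simps)
qed

lemma sum_slot_rotation_off_diagonal:
  assumes ab: "a \<noteq> b" and i: "i a < N" "i b < N"
  shows "(\<Sum>p<N. \<Sum>q<N. slot_rotation a p q (slot_rotation b p q t) i) = -2 * swap_minus_contract N a b t i"
proof -
  let ?s = "t (i \<circ> transpose a b)"
  let ?u = "\<lambda>c. t (i(a := c, b := c))"
  have s: "i(a := i b, b := i a) = i \<circ> transpose a b"
    by (auto simp: fun_eq_iff transpose_def)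
  have eq: "slot_rotation a p q (slot_rotation b p q t) i =
      (if p = i a then if i a = i b then ?u q else 0 else 0) -
      (if q = i b then if p = i a then ?s else 0 else 0) -
      (if p = i b then if q = i a then ?s else 0 else 0) +
      (if q = i a then if i a = i b then ?u p else 0 else 0)" for p q
    using ab s by (auto simp: slot_rotation_def)
  show ?thesis
    unfolding eq using i by (simp add: sum.distrib sum_subtractf sum_if_const swap_minus_contract_def)
qed

lemma slot_rotation_sum: "slot_rotation a p q (\<lambda>i. \<Sum>b\<in>B. f b i) i = (\<Sum>b\<in>B. slot_rotation a p q (f b) i)"
  by (simp add: slot_rotation_def sum_subtractf)

text \<open>The terms of the Casimir operator with both factors in the same slot give the scalar
  \<open>-2 (N - 1)\<close>, those in two different slots a contraction and a transposition.\<close>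

lemma casimir_eq:
  assumes t: "t \<in> tensors N n"
  shows "(\<Sum>p<N. \<Sum>q<N. infinitesimal_rotation N n p q (infinitesimal_rotation N n p q t)) =
    (-4) *\<^sub>C brauer_rep N n (jucys_murphy_sum N n n) t"
proof
  fix i
  show "(\<Sum>p<N. \<Sum>q<N. infinitesimal_rotation N n p q (infinitesimal_rotation N n p q t)) i =
    ((-4) *\<^sub>C brauer_rep N n (jucys_murphy_sum N n n) t) i"
  proof (cases "i \<in> multi_indices N n")
    case True
    let ?I = "{1..n}"
    have lt: "i a < N" if "a \<in> ?I" for a using multi_indices_less[OF True that] .
    have "infinitesimal_rotation N n p q (infinitesimal_rotation N n p q t) i =
        (\<Sum>a\<in>?I. \<Sum>b\<in>?I. slot_rotation a p q (slot_rotation b p q t) i)" if "p < N" "q < N" for p q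
    proof -
      have "infinitesimal_rotation N n p q t j = (\<Sum>b\<in>?I. slot_rotation b p q t j)"
        if "j \<in> (\<lambda>c. i(a := c)) ` {p, q}" "a \<in> ?I" for a j
        using that multi_indices_upd[OF True that(2)] \<open>p < N\<close> \<open>q < N\<close> by (auto simp: infinitesimal_rotation_def)
      then have "slot_rotation a p q (infinitesimal_rotation N n p q t) i =
          slot_rotation a p q (\<lambda>j. \<Sum>b\<in>?I. slot_rotation b p q t j) i" if "a \<in> ?I" for a
        using that unfolding slot_rotation_def[of a]
        by (intro arg_cong2[where f = "(-)"] if_cong refl) auto
      then show ?thesis
        using True
          by (simp add: infinitesimal_rotation_def[of N n p q "infinitesimal_rotation N n p q t"]
            slot_rotation_sum cong: sum.cong_simp)
    qed
    then have "(\<Sum>p<N. \<Sum>q<N. infinitesimal_rotation N n p q (infinitesimal_rotation N n p q t)) i =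
        (\<Sum>p<N. \<Sum>q<N. \<Sum>a\<in>?I. \<Sum>b\<in>?I. slot_rotation a p q (slot_rotation b p q t) i)"
      by (simp add: sum_fun_apply cong: sum.cong_simp)
    also have "\<dots> = (\<Sum>p<N. \<Sum>a\<in>?I. \<Sum>b\<in>?I. \<Sum>q<N. slot_rotation a p q (slot_rotation b p q t) i)"
      by (rule sum.cong[OF refl], rule sum_swap3)
    also have "\<dots> = (\<Sum>a\<in>?I. \<Sum>b\<in>?I. \<Sum>p<N. \<Sum>q<N. slot_rotation a p q (slot_rotation b p q t) i)"
      by (rule sum_swap3)
    also have "\<dots> = (\<Sum>a\<in>?I. (-2 * (of_nat N - 1) * t i) +
        (\<Sum>b\<in>?I - {a}. -2 * swap_minus_contract N a b t i))"
    proof (rule sum.cong[OF refl])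
      fix a assume a: "a \<in> ?I"
      show "(\<Sum>b\<in>?I. \<Sum>p<N. \<Sum>q<N. slot_rotation a p q (slot_rotation b p q t) i) =
          (-2 * (of_nat N - 1) * t i) + (\<Sum>b\<in>?I - {a}. -2 * swap_minus_contract N a b t i)"
        using a lt by (subst sum.remove[OF _ a])
          (auto simp: sum_slot_rotation_diagonal sum_slot_rotation_off_diagonal
            intro!: sum.cong arg_cong2[where f = "(+)"])
    qed
    also have "\<dots> = -4 * (of_nat n * (of_nat N - 1) / 2 * t i +
        1 / 2 * (\<Sum>a\<in>?I. \<Sum>b\<in>?I - {a}. swap_minus_contract N a b t i))"
      by (simp only: sum.distrib sum_distrib_left[symmetric] sum_constant) (simp add: field_simps)
    also have "\<dots> = ((-4) *\<^sub>C brauer_rep N n (jucys_murphy_sum N n n) t) i"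
      by (simp add: brauer_rep_jucys_murphy_sum[OF order_refl t True] scaleC_apply)
    finally show ?thesis .
  next
    case False
    then show ?thesis
      using brauer_rep_mem[of N n "jucys_murphy_sum N n n" t]
      by (simp add: sum_fun_apply infinitesimal_rotation_def scaleC_apply tensors_def)
  qed
qed

section \<open>Infinitesimal rotations as combinations of group elements\<close>

lemma tensor_act_mem: "tensor_act N n g t \<in> tensors N n"
  by (simp add: tensors_def tensor_act_def)

lemma tensor_act_add: "tensor_act N n g (t + t') = tensor_act N n g t + tensor_act N n g t'"
  by (simp add: tensor_act_def fun_eq_iff distrib_left sum.distrib)

lemma tensor_act_scaleC: "tensor_act N n g (c *\<^sub>C t) = c *\<^sub>C tensor_act N n g t"
  by (simp add: tensor_act_def fun_eq_iff scaleC_apply sum_distrib_left mult.left_commute)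

lemma tensor_act_0: "tensor_act N n g 0 = 0"
  using tensor_act_scaleC[of N n g 0 0] by simp

text \<open>Lagrange interpolation in the nodes \<open>0, \<dots>, d\<close>.\<close>

lemma linear_coeff_interpolation:
  "\<exists>c. \<forall>p :: complex poly. degree p \<le> d \<longrightarrow> poly.coeff p 1 = (\<Sum>x\<le>d. c x * poly p (of_nat x))"
proof -
  define L :: "nat \<Rightarrow> complex poly" where
    "L x = (\<Prod>y\<in>{..d} - {x}. smult (1 / (of_nat x - of_nat y)) [:- of_nat y, 1:])" for x
  have L: "poly (L x) (of_nat z) = (if z = x then 1 else 0)" if "x \<le> d" "z \<le> d" for x z
  proof (cases "z = x")
    case True
    then show ?thesis unfolding L_def poly_prod
      by (auto simp: diff_divide_distrib[symmetric] intro!: prod.neutral)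
  next
    case False
    then show ?thesis using that unfolding L_def poly_prod by (auto intro!: prod_zero bexI[of _ z])
  qed
  have deg_L: "degree (L x) \<le> d" if "x \<le> d" for x
  proof -
    have "degree (L x) \<le> (\<Sum>y\<in>{..d} - {x}. degree (smult (1 / (of_nat x - of_nat y :: complex)) [:- of_nat y, 1:]))"
      unfolding L_def by (rule order_trans[OF degree_prod_sum_le]) (simp_all add: comp_def)
    also have "\<dots> \<le> (\<Sum>y\<in>{..d} - {x}. 1)"
      by (rule sum_mono) simp
    finally show ?thesis using that by simp
  qed
  have "poly.coeff p 1 = (\<Sum>x\<le>d. poly.coeff (L x) 1 * poly p (of_nat x))" if p: "degree p \<le> d" for p
  proof -
    let ?q = "\<Sum>x\<le>d. smult (poly p (of_nat x)) (L x)"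
    have "p = ?q"
    proof (rule poly_eqI_degree)
      show "poly p z = poly ?q z" if z: "z \<in> of_nat ` {..d}" for z
      proof -
        obtain x where x: "x \<le> d" "z = of_nat x" using z by auto
        have "poly ?q z = (\<Sum>y\<le>d. if y = x then poly p (of_nat y) else 0)"
          unfolding poly_sum by (rule sum.cong) (use x in \<open>auto simp: L\<close>)
        then show ?thesis using x by simp
      qed
      have card: "card (of_nat ` {..d} :: complex set) = Suc d"
        by (simp add: card_image inj_on_def)
      show "degree p < card (of_nat ` {..d} :: complex set)" using card p by simp
      have "degree ?q \<le> d"
        by (rule degree_sum_le) (use deg_L in \<open>auto intro: order_trans[OF degree_smult_le]\<close>)
      then show "degree ?q < card (of_nat ` {..d} :: complex set)" using card by simp
    qed
    then have "poly.coeff p 1 = poly.coeff ?q 1" by simp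
    then show ?thesis by (simp add: coeff_sum mult.commute)
  qed
  then show ?thesis by (intro exI[of _ "\<lambda>x. poly.coeff (L x) 1"]) blast
qed

text \<open>The entry in row \<open>r\<close> and column \<open>c\<close> of \<open>1 + x\<^sup>2\<close> times the rotation of the \<open>(p, q)\<close>-plane with
  cosine \<open>(1 - x\<^sup>2) / (1 + x\<^sup>2)\<close> and sine \<open>2 x / (1 + x\<^sup>2)\<close>, as a polynomial in \<open>x\<close>.  The constant
  term of this matrix is the unit matrix and its linear term is \<open>2 (E(p, q) - E(q, p))\<close>.\<close>

definition rotation_poly :: "nat \<Rightarrow> nat \<Rightarrow> nat \<Rightarrow> nat \<Rightarrow> complex poly" where
  "rotation_poly p q r c =
     (if r = c then if r = p \<or> r = q then [:1, 0, -1:] else [:1, 0, 1:]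
      else if r = p \<and> c = q then [:0, 2:]
      else if r = q \<and> c = p then [:0, -2:] else 0)"

text \<open>The rational parametrization of the rotations of the \<open>(p, q)\<close>-plane.\<close>

definition rotation :: "nat \<Rightarrow> nat \<Rightarrow> nat \<Rightarrow> complex \<Rightarrow> complex mat" where
  "rotation N p q x = mat N N (\<lambda>(r, c). poly (rotation_poly p q r c) x / (1 + x\<^sup>2))"

lemma rotation_orthogonal:
  assumes pq: "p < N" "q < N" "p \<noteq> q" and x: "1 + x\<^sup>2 \<noteq> 0"
  shows "rotation N p q x \<in> orthogonal_group N"
proof -
  let ?P = "\<lambda>r c. poly (rotation_poly p q r c) x" and ?\<sigma> = "transpose p q"
  define \<alpha> where "\<alpha> r = (if r = p \<or> r = q then 1 - x\<^sup>2 else 1 + x\<^sup>2)" for r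
  define \<beta> where "\<beta> r = (if r = p then 2 * x else if r = q then - 2 * x else 0)" for r
  have P: "?P r c = (if c = r then \<alpha> r else 0) + (if c = ?\<sigma> r then \<beta> r else 0)" for r c
    using pq by (auto simp: rotation_poly_def \<alpha>_def \<beta>_def transpose_def power2_eq_square)
  have "(\<Sum>c<N. ?P r c * ?P s c) = (if r = s then (1 + x\<^sup>2)\<^sup>2 else 0)" if "r < N" "s < N" for r s
  proof -
    have "?\<sigma> r < N" using that pq by (simp add: transpose_def)
    have "(\<Sum>c<N. ?P r c * ?P s c) =
        (\<Sum>c<N. (if c = r then \<alpha> r * ?P s c else 0) + (if c = ?\<sigma> r then \<beta> r * ?P s c else 0))"
      by (rule sum.cong) (auto simp: P[of r] distrib_right)
    also have "\<dots> = \<alpha> r * ?P s r + \<beta> r * ?P s (?\<sigma> r)"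
      using that \<open>?\<sigma> r < N\<close> by (simp add: sum.distrib)
    also have "\<dots> = (if r = s then (1 + x\<^sup>2)\<^sup>2 else 0)"
      using pq(3) unfolding P by (auto simp: \<alpha>_def \<beta>_def transpose_def power2_eq_square algebra_simps)
    finally show ?thesis .
  qed
  then have "rotation N p q x * transpose_mat (rotation N p q x) = 1\<^sub>m N"
    using x by (intro eq_matI)
      (simp_all add: rotation_def scalar_prod_def atLeast0LessThan sum_divide_distrib[symmetric] power2_eq_square)
  then show ?thesis by (simp add: orthogonal_group_def rotation_def)
qed

text \<open>The product rule at \<open>0\<close>.\<close>

lemma coeff_1_mult_prod:
  fixes r :: "complex poly"
  assumes "finite A" "poly.coeff r 0 = 1" "poly.coeff r 1 = 0"
  shows "poly.coeff (r * (\<Prod>a\<in>A. f a)) 1 =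
    (\<Sum>a\<in>A. poly.coeff (f a) 1 * (\<Prod>b\<in>A - {a}. poly.coeff (f b) 0))"
proof -
  have c1: "poly.coeff s 1 = poly (pderiv s) 0" and c0: "poly.coeff s 0 = poly s 0" for s :: "complex poly"
    by (simp_all add: poly_0_coeff_0 coeff_pderiv)
  show ?thesis
    using assms unfolding c0 c1
    by (simp add: pderiv_mult pderiv_prod poly_sum poly_prod mult.commute)
qed

lemma sum_single_slot:
  fixes t :: tensor
  assumes i: "i \<in> multi_indices N m" and a: "a \<in> {1..m}"
  shows "(\<Sum>j\<in>multi_indices N m. h (j a) * (\<Prod>b\<in>{1..m} - {a}. if i b = j b then 1 else 0) * t j) =
    (\<Sum>c<N. h c * t (i(a := c)))"
proof -
  let ?I = "multi_indices N m"
  have inj: "inj_on (\<lambda>c. i(a := c)) {..<N}"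
    by (rule inj_onI) (metis fun_upd_same)
  have set: "{j \<in> ?I. \<forall>b\<in>{1..m} - {a}. i b = j b} = (\<lambda>c. i(a := c)) ` {..<N}"
  proof (intro equalityI subsetI)
    fix j assume j: "j \<in> {j \<in> ?I. \<forall>b\<in>{1..m} - {a}. i b = j b}"
    then have "j = i(a := j a)"
      using a i by (intro multi_indices_eqI[of j N m]) (auto simp: multi_indices_upd multi_indices_less)
    then show "j \<in> (\<lambda>c. i(a := c)) ` {..<N}"
      using j a multi_indices_less by blast
  qed (use a i in \<open>auto simp: multi_indices_upd split: if_splits\<close>)
  have "(\<Prod>b\<in>{1..m} - {a}. if i b = j b then 1 else 0) =
      (if \<forall>b\<in>{1..m} - {a}. i b = j b then 1 else 0 :: complex)" for j
    by (auto intro!: prod.neutral prod_zero)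
  then have "(\<Sum>j\<in>?I. h (j a) * (\<Prod>b\<in>{1..m} - {a}. if i b = j b then 1 else 0) * t j) =
      (\<Sum>j\<in>?I. if \<forall>b\<in>{1..m} - {a}. i b = j b then h (j a) * t j else 0)"
    by (intro sum.cong) auto
  also have "\<dots> = (\<Sum>j\<in>(\<lambda>c. i(a := c)) ` {..<N}. h (j a) * t j)"
    unfolding set[symmetric] by (simp add: sum.If_cases finite_multi_indices Int_def)
  also have "\<dots> = (\<Sum>c<N. h c * t (i(a := c)))"
    by (simp add: sum.reindex[OF inj])
  finally show ?thesis .
qed

text \<open>Neither the coefficients \<open>w\<close> nor the group elements \<open>g\<close> depend on \<open>m\<close>.  So a linear map between
  two tensor powers that commutes with the group also commutes with infinitesimal rotations.\<close>

lemma infinitesimal_rotation_eq_group_combination: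
  assumes pq: "p < N" "q < N"
  shows "\<exists>d w g. (\<forall>x::nat. g x \<in> orthogonal_group N) \<and> (\<forall>m\<le>M. \<forall>t.
    infinitesimal_rotation N m p q t = (\<Sum>x\<le>d. w x *\<^sub>C tensor_act N m (g x) t))"
proof (cases "p = q")
  case True
  have "1\<^sub>m N \<in> orthogonal_group N" by (simp add: orthogonal_group_def)
  moreover have "infinitesimal_rotation N m p q t = 0" for m t
    using True by (simp add: infinitesimal_rotation_def slot_rotation_def fun_eq_iff)
  ultimately show ?thesis
    by (intro exI[of _ 0] exI[of _ "\<lambda>_. 0"] exI[of _ "\<lambda>_. 1\<^sub>m N"]) simp
next
  case False
  obtain c where c: "\<And>P :: complex poly. degree P \<le> 2 * M \<Longrightarrow>
      poly.coeff P 1 = (\<Sum>x\<le>2 * M. c x * poly P (of_nat x))"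
    using linear_coeff_interpolation by blast
  define g where "g x = rotation N p q (of_nat x)" for x :: nat
  \<comment> \<open>The factor \<open>1 / 2\<close> makes up for the linear term \<open>2 (E(p, q) - E(q, p))\<close> of the rotation.\<close>
  define w where "w x = c x * (1 + (of_nat x)\<^sup>2) ^ M / 2" for x :: nat
  have nz: "1 + (of_nat x)\<^sup>2 \<noteq> (0::complex)" for x :: nat
  proof -
    have "1 + (of_nat x)\<^sup>2 = (of_nat (1 + x\<^sup>2) :: complex)" by simp
    then show ?thesis by (metis add_is_0 of_nat_eq_0_iff one_neq_zero)
  qed
  have g: "g x \<in> orthogonal_group N" for x
    unfolding g_def by (rule rotation_orthogonal[OF pq False nz])
  have "infinitesimal_rotation N m p q t i = (\<Sum>x\<le>2 * M. w x *\<^sub>C tensor_act N m (g x) t) i" if m: "m \<le> M" for m t i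
  proof (cases "i \<in> multi_indices N m")
    case True
    let ?I = "multi_indices N m"
    \<comment> \<open>The factor \<open>r\<close> raises the power of the denominator from \<open>m\<close> to \<open>M\<close>; it has no linear term.\<close>
    define r :: "complex poly" where "r = [:1, 0, 1:] ^ (M - m)"
    define P where "P j = r * (\<Prod>a\<in>{1..m}. rotation_poly p q (i a) (j a))" for j
    have r: "poly.coeff r 0 = 1" "poly.coeff r 1 = 0"
    proof -
      show "poly.coeff r 0 = 1" by (simp add: r_def poly_0_coeff_0[symmetric])
      have "poly.coeff r 1 = poly (pderiv r) 0" by (simp add: poly_0_coeff_0 coeff_pderiv)
      also have "\<dots> = 0" by (simp add: r_def pderiv_power pderiv_pCons)
      finally show "poly.coeff r 1 = 0" .
    qed
    have deg: "degree (P j) \<le> 2 * M" for j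
    proof -
      have "degree (\<Prod>a\<in>{1..m}. rotation_poly p q (i a) (j a)) \<le> (\<Sum>a\<in>{1..m}. degree (rotation_poly p q (i a) (j a)))"
        by (rule order_trans[OF degree_prod_sum_le]) (simp_all add: comp_def)
      also have "\<dots> \<le> (\<Sum>a\<in>{1..m}. 2)"
        by (rule sum_mono) (simp add: rotation_poly_def)
      finally have "degree (\<Prod>a\<in>{1..m}. rotation_poly p q (i a) (j a)) \<le> 2 * m" by simp
      moreover have "degree r \<le> 2 * (M - m)"
        unfolding r_def using degree_power_le[of "[:1, 0, 1:] :: complex poly" "M - m"] by simp
      ultimately have "degree (P j) \<le> 2 * (M - m) + 2 * m"
        unfolding P_def using degree_mult_le[of r] by (meson add_mono order_trans)
      then show ?thesis using m by simp
    qed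
    have poly_P: "poly (P j) (of_nat x) = (1 + (of_nat x)\<^sup>2) ^ M * (\<Prod>a\<in>{1..m}. g x $$ (i a, j a))"
      if j: "j \<in> ?I" for j x
    proof -
      have "(\<Prod>a\<in>{1..m}. poly (rotation_poly p q (i a) (j a)) (of_nat x)) =
          (\<Prod>a\<in>{1..m}. (1 + (of_nat x)\<^sup>2) * g x $$ (i a, j a))"
        using multi_indices_less[OF True] multi_indices_less[OF j] nz[of x]
        by (intro prod.cong) (simp_all add: g_def rotation_def)
      also have "\<dots> = (1 + (of_nat x)\<^sup>2) ^ m * (\<Prod>a\<in>{1..m}. g x $$ (i a, j a))"
        by (simp add: prod.distrib)
      finally have "poly (P j) (of_nat x) =
          (1 + (of_nat x)\<^sup>2) ^ (M - m) * ((1 + (of_nat x)\<^sup>2) ^ m * (\<Prod>a\<in>{1..m}. g x $$ (i a, j a)))"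
        by (simp add: P_def r_def poly_prod power2_eq_square)
      then show ?thesis using m by (simp add: mult.assoc[symmetric] power_add[symmetric])
    qed
    have coeff0: "poly.coeff (rotation_poly p q u v) 0 = (if u = v then 1 else 0)" for u v
      by (simp add: rotation_poly_def)
    have "(\<Sum>j\<in>?I. poly.coeff (rotation_poly p q (i a) (j a)) 1 *
        (\<Prod>b\<in>{1..m} - {a}. if i b = j b then 1 else 0) * t j) = 2 * slot_rotation a p q t i"
      if a: "a \<in> {1..m}" for a
    proof -
      have "poly.coeff (rotation_poly p q (i a) v) 1 * t (i(a := v)) =
          (if v = q then if i a = p then 2 * t (i(a := q)) else 0 else 0) -
          (if v = p then if i a = q then 2 * t (i(a := p)) else 0 else 0)" for v
        using False by (auto simp: rotation_poly_def)
      then show ?thesis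
        using pq unfolding sum_single_slot[OF True a, of "\<lambda>v. poly.coeff (rotation_poly p q (i a) v) 1"]
        by (simp add: sum_subtractf slot_rotation_def)
    qed
    then have "2 * infinitesimal_rotation N m p q t i =
        (\<Sum>a\<in>{1..m}. \<Sum>j\<in>?I. poly.coeff (rotation_poly p q (i a) (j a)) 1 *
        (\<Prod>b\<in>{1..m} - {a}. if i b = j b then 1 else 0) * t j)"
      using True by (simp add: infinitesimal_rotation_def sum_distrib_left cong: sum.cong_simp)
    also have "\<dots> = (\<Sum>j\<in>?I. \<Sum>a\<in>{1..m}. poly.coeff (rotation_poly p q (i a) (j a)) 1 *
        (\<Prod>b\<in>{1..m} - {a}. if i b = j b then 1 else 0) * t j)"
      by (rule sum.swap)
    also have "\<dots> = (\<Sum>j\<in>?I. poly.coeff (P j) 1 * t j)"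
      unfolding P_def coeff_1_mult_prod[OF finite_atLeastAtMost r] coeff0 by (simp add: sum_distrib_right)
    also have "\<dots> = (\<Sum>j\<in>?I. \<Sum>x\<le>2 * M. 2 * w x * ((\<Prod>a\<in>{1..m}. g x $$ (i a, j a)) * t j))"
      unfolding c[OF deg] by (rule sum.cong[OF refl])
        (simp add: poly_P w_def sum_distrib_left sum_distrib_right mult_ac)
    also have "\<dots> = (\<Sum>x\<le>2 * M. \<Sum>j\<in>?I. 2 * w x * ((\<Prod>a\<in>{1..m}. g x $$ (i a, j a)) * t j))"
      by (rule sum.swap)
    also have "\<dots> = 2 * (\<Sum>x\<le>2 * M. w x *\<^sub>C tensor_act N m (g x) t) i"
      using True by (simp add: sum_fun_apply scaleC_apply tensor_act_def sum_distrib_left mult.assoc)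
    finally show ?thesis by simp
  next
    case False
    then show ?thesis by (simp add: infinitesimal_rotation_def sum_fun_apply scaleC_apply tensor_act_def)
  qed
  then have "infinitesimal_rotation N m p q t = (\<Sum>x\<le>2 * M. w x *\<^sub>C tensor_act N m (g x) t)" if "m \<le> M" for m t
    using that by blast
  then show ?thesis using g by blast
qed

section \<open>The Brauer action commutes with the orthogonal group\<close>

lemma orthogonal_group_entries:
  assumes g: "g \<in> orthogonal_group N" and r: "r < N" "s < N"
  shows "(\<Sum>c<N. g $$ (r, c) * g $$ (s, c)) = (if r = s then 1 else 0)"
    and "(\<Sum>c<N. g $$ (c, r) * g $$ (c, s)) = (if r = s then 1 else 0)"
proof -
  have c: "g \<in> carrier_mat N N" and o: "g * transpose_mat g = 1\<^sub>m N"
    using g by (auto simp: orthogonal_group_def)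
  have o': "transpose_mat g * g = 1\<^sub>m N"
    by (rule mat_mult_left_right_inverse[OF c _ o]) (use c in simp)
  have "(g * transpose_mat g) $$ (r, s) = (\<Sum>c<N. g $$ (r, c) * g $$ (s, c))"
    using c r by (simp add: scalar_prod_def atLeast0LessThan)
  then show "(\<Sum>c<N. g $$ (r, c) * g $$ (s, c)) = (if r = s then 1 else 0)"
    using o r by simp
  have "(transpose_mat g * g) $$ (r, s) = (\<Sum>c<N. g $$ (c, r) * g $$ (c, s))"
    using c r by (simp add: scalar_prod_def atLeast0LessThan)
  then show "(\<Sum>c<N. g $$ (c, r) * g $$ (c, s)) = (if r = s then 1 else 0)"
    using o' r by simp
qed

lemma graph_act_perm_equivariant:
  assumes s: "s permutes {1..n}" and t: "t \<in> tensors N n"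
  shows "graph_act N n (perm_graph n s) (tensor_act N n g t) =
    tensor_act N n g (graph_act N n (perm_graph n s) t)"
proof -
  let ?I = "multi_indices N n"
  have "tensor_act N n g t (i \<circ> s) = tensor_act N n g (\<lambda>i. t (i \<circ> s)) i" for i
  proof -
    have "(\<Prod>a\<in>{1..n}. g $$ (i (s a), (j \<circ> s) a)) = (\<Prod>a\<in>{1..n}. g $$ (i a, j a))" for j
      using prod.permute[OF s, of "\<lambda>a. g $$ (i a, j a)"] by (simp add: comp_def)
    moreover have "bij_betw (\<lambda>j. j \<circ> s) ?I ?I"
    proof (rule bij_betw_byWitness[where f' = "\<lambda>j. j \<circ> inv_into UNIV s"])
      show "\<forall>j\<in>?I. (j \<circ> s) \<circ> inv_into UNIV s = j" "\<forall>j\<in>?I. (j \<circ> inv_into UNIV s) \<circ> s = j"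
        by (simp_all add: comp_assoc permutes_inv_o[OF s])
    qed (use multi_indices_compose_iff[OF s] multi_indices_compose_iff[OF permutes_inv[OF s]] in auto)
    ultimately have "(\<Sum>j\<in>?I. (\<Prod>a\<in>{1..n}. g $$ (i (s a), j a)) * t j) =
        (\<Sum>j\<in>?I. (\<Prod>a\<in>{1..n}. g $$ (i a, j a)) * t (j \<circ> s))"
      using sum.reindex_bij_betw[of "\<lambda>j. j \<circ> s" ?I ?I "\<lambda>j. (\<Prod>a\<in>{1..n}. g $$ (i (s a), j a)) * t j"] by simp
    then show ?thesis
      by (simp add: tensor_act_def multi_indices_compose_iff[OF s])
  qed
  then show ?thesis
    by (simp add: graph_act_perm[OF s t] graph_act_perm[OF s tensor_act_mem] fun_eq_iff)
qed

lemma graph_act_bar_equivariant: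
  assumes kl: "k \<in> {1..n}" "l \<in> {1..n}" "k \<noteq> l" and g: "g \<in> orthogonal_group N"
  shows "graph_act N n (bar_graph n k l) (tensor_act N n g t) =
    tensor_act N n g (graph_act N n (bar_graph n k l) t)"
proof
  fix i
  let ?I = "multi_indices N n"
  let ?b = "\<lambda>i j. constant_on_edges (vertex_label i j) (bar_graph n k l)"
  let ?G = "\<lambda>i j. \<Prod>a\<in>{1..n}. g $$ (i a, j a)"
  define R where "R i j = (\<Prod>a\<in>{1..n} - {k, l}. g $$ (i a, j a))" for i j
  \<comment> \<open>\<open>H\<close> is the matrix of both composites, by the orthonormality of the columns of \<open>g\<close> for the one
    and of its rows for the other.\<close>
  define H where "H i j = (if i k = i l \<and> j k = j l then R i j else 0)" for i j
  have G: "?G i j = g $$ (i k, j k) * (g $$ (i l, j l) * R i j)" for i j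
  proof -
    have "?G i j = g $$ (i k, j k) * (g $$ (i l, j l) * (\<Prod>a\<in>{1..n} - {k} - {l}. g $$ (i a, j a)))"
      using kl by (subst prod.remove[of _ k], simp, simp, subst prod.remove[of _ l]) auto
    moreover have "{1..n} - {k} - {l} = {1..n} - {k, l}" by auto
    ultimately show ?thesis by (simp add: R_def)
  qed
  have R_upd: "R (i(k := c, l := c)) j = R i j" "R i (j(k := c, l := c)) = R i j" for i j c
    by (auto simp: R_def intro!: prod.cong)
  have G_upd: "?G (i(k := c, l := c)) j = g $$ (c, j k) * g $$ (c, j l) * R i j"
    "?G i (j(k := c, l := c)) = g $$ (i k, c) * g $$ (i l, c) * R i j" for i j c
    unfolding G R_upd using kl by simp_all
  have 1: "(\<Sum>j'\<in>?I. if ?b i j' then ?G j' j else 0) = H i j" if "i \<in> ?I" "j \<in> ?I" for i j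
  proof -
    have "(\<Sum>j'\<in>?I. if ?b i j' then ?G j' j else 0) = graph_act N n (bar_graph n k l) (\<lambda>i. ?G i j) i"
      by (simp only: graph_act_def that if_True)
    also have "\<dots> = (if i k = i l then (\<Sum>c<N. g $$ (c, j k) * g $$ (c, j l)) * R i j else 0)"
      unfolding graph_act_bar[OF kl that(1)] G_upd sum_distrib_right ..
    finally show ?thesis
      unfolding orthogonal_group_entries(2)[OF g multi_indices_less multi_indices_less, OF that(2) kl(1) that(2) kl(2)]
      by (simp add: H_def)
  qed
  have 2: "(\<Sum>j'\<in>?I. if ?b j' j then ?G i j' else 0) = H i j" if "i \<in> ?I" "j \<in> ?I" for i j
  proof -
    have "?b j' j = ?b j j'" for j'
      unfolding constant_on_bar_graph[OF kl] by metis
    then have "(\<Sum>j'\<in>?I. if ?b j' j then ?G i j' else 0) = graph_act N n (bar_graph n k l) (\<lambda>j. ?G i j) j"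
      by (simp only: graph_act_def that if_True)
    also have "\<dots> = (if j k = j l then (\<Sum>c<N. g $$ (i k, c) * g $$ (i l, c)) * R i j else 0)"
      unfolding graph_act_bar[OF kl that(2)] G_upd sum_distrib_right ..
    finally show ?thesis
      unfolding orthogonal_group_entries(1)[OF g multi_indices_less multi_indices_less, OF that(1) kl(1) that(1) kl(2)]
      by (simp add: H_def)
  qed
  show "graph_act N n (bar_graph n k l) (tensor_act N n g t) i =
    tensor_act N n g (graph_act N n (bar_graph n k l) t) i"
  proof (cases "i \<in> ?I")
    case True
    have "graph_act N n (bar_graph n k l) (tensor_act N n g t) i =
        (\<Sum>j'\<in>?I. \<Sum>j\<in>?I. (if ?b i j' then ?G j' j else 0) * t j)"
      using True by (auto simp: graph_act_def tensor_act_def intro!: sum.cong)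
    also have "\<dots> = (\<Sum>j\<in>?I. H i j * t j)"
      by (subst sum.swap) (simp add: sum_distrib_right[symmetric] 1[OF True] cong: sum.cong_simp)
    also have "\<dots> = (\<Sum>j'\<in>?I. \<Sum>j\<in>?I. (if ?b j' j then ?G i j' else 0) * t j)"
      by (rule trans[OF _ sum.swap]) (simp add: sum_distrib_right[symmetric] 2[OF True] cong: sum.cong_simp)
    also have "\<dots> = tensor_act N n g (graph_act N n (bar_graph n k l) t) i"
      using True by (auto simp: graph_act_def tensor_act_def sum_distrib_left intro!: sum.cong)
    finally show ?thesis .
  next
    case False
    then show ?thesis by (simp add: graph_act_def tensor_act_def)
  qed
qed

lemma jucys_murphy_sum_equivariant:
  assumes k: "k \<le> n" and g: "g \<in> orthogonal_group N" and t: "t \<in> tensors N n"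
  shows "brauer_rep N n (jucys_murphy_sum N n k) (tensor_act N n g t) =
    tensor_act N n g (brauer_rep N n (jucys_murphy_sum N n k) t)"
proof -
  \<comment> \<open>The algebra elements that commute with \<open>g\<close> on \<open>t\<close> form a subspace.\<close>
  define E where "E = {x. brauer_rep N n x (tensor_act N n g t) = tensor_act N n g (brauer_rep N n x t)}"
  have E: "complex_space.subspace E"
  proof (rule complex_space.subspaceI)
    show "0 \<in> E" unfolding E_def mem_Collect_eq brauer_rep_0 tensor_act_0 ..
  qed (auto simp only: E_def mem_Collect_eq brauer_rep_add brauer_rep_scaleC tensor_act_add tensor_act_scaleC)
  have perm: "brauer_basis (perm_graph n s) \<in> E" if "s permutes {1..n}" for s
    using graph_act_perm_equivariant[OF that t]
    by (simp add: E_def brauer_rep_basis[OF perm_graph_mem[OF that]] t tensor_act_mem)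
  have bar: "brauer_basis (bar_graph n a b) \<in> E" if "a \<in> {1..n}" "b \<in> {1..n}" "a \<noteq> b" for a b
    using graph_act_bar_equivariant[OF that g]
    by (simp add: E_def brauer_rep_basis[OF bar_graph_mem[OF that]] t tensor_act_mem)
  have "jucys_murphy N n m \<in> E" if m: "m \<in> {1..n}" for m
    unfolding jucys_murphy_def
  proof (intro complex_space.subspace_add[OF E] complex_space.subspace_scale[OF E]
      complex_space.subspace_sum[OF E] complex_space.subspace_diff[OF E])
    fix l assume "l \<in> {1..<m}"
    then have l: "l \<in> {1..n}" "m \<noteq> l" using m by auto
    show "brauer_basis (perm_graph n (transpose m l)) \<in> E" "brauer_basis (bar_graph n m l) \<in> E"
      using perm[OF permutes_swap_id[OF m l(1)]] bar[OF m l] by simp_all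
  qed (rule perm[OF permutes_id])
  then have "jucys_murphy_sum N n k \<in> E"
    unfolding jucys_murphy_sum_def using k by (intro complex_space.subspace_sum[OF E]) auto
  then show ?thesis by (simp add: E_def)
qed

lemma jucys_murphy_sum_mem_centralizer:
  "brauer_rep N k (jucys_murphy_sum N k k) \<in> centralizer_algebra N k"
  unfolding centralizer_algebra_def intertwiners_def
  by (simp add: brauer_rep_mem brauer_rep_add_right brauer_rep_scaleC_right
      jucys_murphy_sum_equivariant brauer_rep_outside)

text \<open>The embedding of \<open>C(k, N)\<close> into \<open>C(n, N)\<close> takes the action of \<open>x\<^sub>1 + \<dots> + x\<^sub>k\<close> in \<open>B(k, N)\<close> to
  that of the same element of \<open>B(n, N)\<close>.\<close>

lemma centralizer_embed_jucys_murphy_sum: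
  assumes k: "k \<le> n" and t: "t \<in> tensors N n"
  shows "centralizer_embed N k n (brauer_rep N k (jucys_murphy_sum N k k)) t =
    brauer_rep N n (jucys_murphy_sum N n k) t"
proof
  fix i
  show "centralizer_embed N k n (brauer_rep N k (jucys_murphy_sum N k k)) t i =
    brauer_rep N n (jucys_murphy_sum N n k) t i"
  proof (cases "i \<in> multi_indices N n")
    case True
    define s where "s = (\<lambda>j. if j \<in> multi_indices N k then t (\<lambda>a. if a \<in> {1..k} then j a else i a) else 0)"
    define i' where "i' = restrict i {1..k}"
    have s: "s \<in> tensors N k" by (simp add: s_def tensors_def)
    have i': "i' \<in> multi_indices N k"
      using True k by (auto simp: i'_def multi_indices_def PiE_iff)
    have s_eq: "s j = t j'" if "j \<in> multi_indices N k" "\<And>a. (if a \<in> {1..k} then j a else i a) = j' a" for j j'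
      using that by (simp add: s_def)
    have pair: "swap_minus_contract N a b s i' = swap_minus_contract N a b t i"
      if a: "a \<in> {1..k}" and b: "b \<in> {1..k}" for a b
    proof -
      have "s (i' \<circ> transpose a b) = t (i \<circ> transpose a b)"
        using a b multi_indices_compose_iff[OF permutes_swap_id[OF a b]] i'
        by (intro s_eq) (auto simp: i'_def transpose_def)
      moreover have "s (i'(a := c, b := c)) = t (i(a := c, b := c))" if "c < N" for c
        using a b i' that by (intro s_eq multi_indices_upd) (auto simp: i'_def)
      moreover have "i' a = i a" "i' b = i b" using a b by (simp_all add: i'_def)
      ultimately show ?thesis by (simp add: swap_minus_contract_def)
    qed
    have "centralizer_embed N k n (brauer_rep N k (jucys_murphy_sum N k k)) t i =
        brauer_rep N k (jucys_murphy_sum N k k) s i'"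
      using t True by (simp add: centralizer_embed_def s_def i'_def)
    also have "\<dots> = of_nat k * (of_nat N - 1) / 2 * s i' +
        1 / 2 * (\<Sum>a\<in>{1..k}. \<Sum>b\<in>{1..k} - {a}. swap_minus_contract N a b s i')"
      by (rule brauer_rep_jucys_murphy_sum[OF order_refl s i'])
    also have "s i' = t i"
      by (rule s_eq[OF i']) (simp add: i'_def)
    also have "(\<Sum>a\<in>{1..k}. \<Sum>b\<in>{1..k} - {a}. swap_minus_contract N a b s i') =
        (\<Sum>a\<in>{1..k}. \<Sum>b\<in>{1..k} - {a}. swap_minus_contract N a b t i)"
      by (intro sum.cong refl pair) auto
    finally show ?thesis
      by (simp add: brauer_rep_jucys_murphy_sum[OF k t True])
  next
    case False
    then show ?thesis
      using t brauer_rep_mem[of N n "jucys_murphy_sum N n k" t]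
      by (simp add: centralizer_embed_def tensors_def)
  qed
qed

section \<open>Weyl modules and spaces of intertwiners\<close>

lemma intertwinersD:
  assumes "f \<in> intertwiners A \<rho> V \<sigma> W"
  shows "x \<in> V \<Longrightarrow> f x \<in> W" "x \<notin> V \<Longrightarrow> f x = 0"
    "x \<in> V \<Longrightarrow> y \<in> V \<Longrightarrow> f (x + y) = f x + f y"
    "x \<in> V \<Longrightarrow> f (c *\<^sub>C x) = c *\<^sub>C f x"
    "a \<in> A \<Longrightarrow> x \<in> V \<Longrightarrow> f (\<rho> a x) = \<sigma> a (f x)"
  using assms unfolding intertwiners_def by blast+

lemma intertwiner_sum:
  assumes f: "f \<in> intertwiners A \<rho> V \<sigma> W" and V: "complex_space.subspace V"
    and x: "\<And>a. a \<in> B \<Longrightarrow> x a \<in> V"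
  shows "f (\<Sum>a\<in>B. x a) = (\<Sum>a\<in>B. f (x a))"
proof -
  have f0: "f 0 = 0"
    using intertwinersD(4)[OF f complex_space.subspace_0[OF V], of 0] by simp
  show ?thesis
    using x
  proof (induction B rule: infinite_finite_induct)
    case (insert a B)
    have "sum x B \<in> V" using insert.prems by (intro complex_space.subspace_sum[OF V]) auto
    then show ?case
      using insert unfolding sum.insert[OF insert.hyps]
      by (subst intertwinersD(3)[OF f]) auto
  qed (simp_all only: sum.infinite sum.empty f0 not_False_eq_True)
qed

lemma subspace_intertwiners:
  assumes W: "complex_space.subspace W"
    and add: "\<And>a x y. a \<in> A \<Longrightarrow> x \<in> W \<Longrightarrow> y \<in> W \<Longrightarrow> \<sigma> a (x + y) = \<sigma> a x + \<sigma> a y"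
    and scale: "\<And>a c x. a \<in> A \<Longrightarrow> x \<in> W \<Longrightarrow> \<sigma> a (c *\<^sub>C x) = c *\<^sub>C \<sigma> a x"
  shows "complex_space.subspace (intertwiners A \<rho> V \<sigma> W)"
proof (rule complex_space.subspaceI)
  have "\<sigma> a 0 = 0" if "a \<in> A" for a
    using scale[OF that complex_space.subspace_0[OF W], of 0] by simp
  then show "0 \<in> intertwiners A \<rho> V \<sigma> W"
    using complex_space.subspace_0[OF W] by (simp add: intertwiners_def)
next
  fix f f' assume "f \<in> intertwiners A \<rho> V \<sigma> W" "f' \<in> intertwiners A \<rho> V \<sigma> W"
  note f = intertwinersD[OF this(1)] and f' = intertwinersD[OF this(2)]
  show "f + f' \<in> intertwiners A \<rho> V \<sigma> W"
    unfolding intertwiners_def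
    by (auto simp: f f' add scaleC_add_right complex_space.subspace_add[OF W])
next
  fix c f assume "f \<in> intertwiners A \<rho> V \<sigma> W"
  note f = intertwinersD[OF this]
  show "c *\<^sub>C f \<in> intertwiners A \<rho> V \<sigma> W"
    unfolding intertwiners_def
    by (auto simp: scaleC_fun_def f scale scaleC_add_right scaleC_scaleC mult.commute
        complex_space.subspace_scale[OF W])
qed

lemma subspace_specht_module: "complex_space.subspace (specht_module lam)"
  by (simp add: specht_module_def)

lemma subspace_traceless_tensors: "complex_space.subspace (traceless_tensors N m)"
proof (rule complex_space.subspaceI)
  show "0 \<in> traceless_tensors N m"
    by (simp add: traceless_tensors_def brauer_rep_0_right)
qed (auto simp: traceless_tensors_def brauer_rep_add_right brauer_rep_scaleC_right
    complex_space.subspace_add[OF subspace_tensors] complex_space.subspace_scale[OF subspace_tensors])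

lemma traceless_tensors_subset: "t \<in> traceless_tensors N m \<Longrightarrow> t \<in> tensors N m"
  by (simp add: traceless_tensors_def)

lemma weyl_module_mem_tensors:
  assumes "u \<in> weyl_module N lam"
  shows "u f \<in> tensors N (card lam)"
proof (cases "f \<in> specht_module lam")
  case True
  then show ?thesis
    using intertwinersD(1)[OF assms[unfolded weyl_module_def]] traceless_tensors_subset by blast
qed (simp add: intertwinersD(2)[OF assms[unfolded weyl_module_def]])

lemma subspace_weyl_module: "complex_space.subspace (weyl_module N lam)"
  unfolding weyl_module_def
  by (rule subspace_intertwiners[OF subspace_traceless_tensors])
    (simp_all add: perm_act_def brauer_rep_add_right brauer_rep_scaleC_right traceless_tensors_subset)

lemma weyl_act_mem:
  assumes g: "g \<in> orthogonal_group N" and u: "u \<in> weyl_module N lam"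
  shows "weyl_act N lam g u \<in> weyl_module N lam"
proof -
  let ?m = "card lam"
  note D = intertwinersD[OF u[unfolded weyl_module_def]]
  have traceless: "tensor_act N ?m g t \<in> traceless_tensors N ?m" if t: "t \<in> traceless_tensors N ?m" for t
  proof -
    have "brauer_rep N ?m (brauer_basis (bar_graph ?m k l)) (tensor_act N ?m g t) = 0"
      if kl: "k \<in> {1..?m}" "l \<in> {1..?m}" "k \<noteq> l" for k l
    proof -
      have "brauer_rep N ?m (brauer_basis (bar_graph ?m k l)) (tensor_act N ?m g t) =
          tensor_act N ?m g (brauer_rep N ?m (brauer_basis (bar_graph ?m k l)) t)"
        by (simp add: brauer_rep_basis[OF bar_graph_mem[OF kl]] tensor_act_mem
            traceless_tensors_subset[OF t] graph_act_bar_equivariant[OF kl g])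
      also have "\<dots> = 0" using t kl by (simp add: traceless_tensors_def tensor_act_0)
      finally show ?thesis .
    qed
    then show ?thesis by (simp add: traceless_tensors_def tensor_act_mem)
  qed
  have perm: "tensor_act N ?m g (perm_act N ?m s t) = perm_act N ?m s (tensor_act N ?m g t)"
    if "s permutes {1..?m}" "t \<in> tensors N ?m" for s t
    using that by (simp add: perm_act_def brauer_rep_basis[OF perm_graph_mem] tensor_act_mem
        graph_act_perm_equivariant)
  show ?thesis
    unfolding weyl_module_def intertwiners_def weyl_act_def
    by (auto simp: D traceless perm tensor_act_0 tensor_act_add tensor_act_scaleC traceless_tensors_subset)
qed

section \<open>Eigenvalues of the partial sums of Jucys-Murphy elements\<close>

text \<open>The eigenvalue of \<open>x\<^sub>1 + \<dots> + x\<^sub>k\<close> on \<open>V(lam, k)\<close>, which does not depend on \<open>k\<close>.\<close>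

definition jucys_murphy_sum_value :: "nat \<Rightarrow> diagram \<Rightarrow> complex" where
  "jucys_murphy_sum_value N lam = of_nat (card lam) * (of_nat N - 1) / 2 + diagram_content lam"

text \<open>The contractions vanish on the values of \<open>u\<close>, which are traceless, and \<open>u\<close> carries the sum of all
  transpositions over to the Specht module.\<close>

lemma jucys_murphy_sum_weyl:
  assumes lam: "young_diagram lam" and u: "u \<in> weyl_module N lam"
  shows "brauer_rep N (card lam) (jucys_murphy_sum N (card lam) (card lam)) (u f) =
    jucys_murphy_sum_value N lam *\<^sub>C u f"
proof (cases "f \<in> specht_module lam")
  case f: True
  let ?m = "card lam"
  note D = intertwinersD[OF u[unfolded weyl_module_def]]
  have tr: "u f \<in> traceless_tensors N ?m" using D(1)[OF f] .
  note t = traceless_tensors_subset[OF tr]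
  have "brauer_rep N ?m (jucys_murphy_sum N ?m ?m) (u f) i = (jucys_murphy_sum_value N lam *\<^sub>C u f) i"
    if i: "i \<in> multi_indices N ?m" for i
  proof -
    have pair: "swap_minus_contract N a b (u f) i = u (perm_mult (transpose a b) f) i"
      if a: "a \<in> {1..?m}" and b: "b \<in> {1..?m} - {a}" for a b
    proof -
      have b': "b \<in> {1..?m}" "a \<noteq> b" using b by auto
      note s = permutes_swap_id[OF a b'(1)]
      have "brauer_rep N ?m (brauer_basis (bar_graph ?m a b)) (u f) = 0"
        using tr a b' unfolding traceless_tensors_def by blast
      then have "graph_act N ?m (bar_graph ?m a b) (u f) i = 0"
        by (simp add: brauer_rep_basis[OF bar_graph_mem[OF a b'] t])
      then have "swap_minus_contract N a b (u f) i = u f (i \<circ> transpose a b)"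
        unfolding graph_act_bar[OF a b' i] by (simp add: swap_minus_contract_def)
      also have "\<dots> = perm_act N ?m (transpose a b) (u f) i"
        by (simp add: perm_act_def brauer_rep_basis[OF perm_graph_mem[OF s] t] graph_act_perm[OF s t])
      also have "\<dots> = u (perm_mult (transpose a b) f) i"
        using D(5)[OF _ f, of "transpose a b"] s by simp
      finally show ?thesis .
    qed
    have mem: "perm_mult (transpose a b) f \<in> specht_module lam"
      if "a \<in> {1..?m}" "b \<in> {1..?m} - {a}" for a b
      using that by (intro perm_mult_specht[OF permutes_swap_id f]) auto
    have "(\<Sum>a\<in>{1..?m}. \<Sum>b\<in>{1..?m} - {a}. swap_minus_contract N a b (u f) i) =
        (\<Sum>a\<in>{1..?m}. \<Sum>b\<in>{1..?m} - {a}. u (perm_mult (transpose a b) f) i)"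
      by (intro sum.cong refl pair)
    also have "\<dots> = (\<Sum>a\<in>{1..?m}. \<Sum>b\<in>{1..?m} - {a}. u (perm_mult (transpose a b) f)) i"
      by (simp only: sum_fun_apply)
    also have "(\<Sum>a\<in>{1..?m}. \<Sum>b\<in>{1..?m} - {a}. u (perm_mult (transpose a b) f)) =
        (\<Sum>a\<in>{1..?m}. u (\<Sum>b\<in>{1..?m} - {a}. perm_mult (transpose a b) f))"
      by (intro sum.cong refl intertwiner_sum[OF u[unfolded weyl_module_def] subspace_specht_module, symmetric] mem)
    also have "\<dots> = u (transposition_sum ?m f)"
      unfolding transposition_sum_def
      by (intro intertwiner_sum[OF u[unfolded weyl_module_def] subspace_specht_module, symmetric]
          complex_space.subspace_sum[OF subspace_specht_module] mem)
    also have "\<dots> = (2 * diagram_content lam) *\<^sub>C u f"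
      unfolding transposition_sum_specht[OF lam f] by (rule D(4)[OF f])
    finally show ?thesis
      unfolding brauer_rep_jucys_murphy_sum[OF order_refl t i]
      by (simp add: scaleC_apply jucys_murphy_sum_value_def algebra_simps)
  qed
  moreover have "brauer_rep N ?m (jucys_murphy_sum N ?m ?m) (u f) i = (jucys_murphy_sum_value N lam *\<^sub>C u f) i"
    if "i \<notin> multi_indices N ?m" for i
    using that t brauer_rep_mem[of N ?m "jucys_murphy_sum N ?m ?m" "u f"]
    by (simp add: tensors_def scaleC_apply)
  ultimately show ?thesis by blast
next
  case False
  then have "u f = 0" using intertwinersD(2)[OF u[unfolded weyl_module_def]] by blast
  then show ?thesis by (simp add: brauer_rep_0_right)
qed

lemma infinitesimal_rotation_equivariant:
  assumes v: "v \<in> centralizer_module N n lam" and u: "u \<in> weyl_module N lam" and pq: "p < N" "q < N"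
  shows "infinitesimal_rotation N (card lam) p q \<circ> u \<in> weyl_module N lam"
    and "v (infinitesimal_rotation N (card lam) p q \<circ> u) = infinitesimal_rotation N n p q (v u)"
proof -
  obtain d w g where g: "\<And>x::nat. g x \<in> orthogonal_group N"
    and comb: "\<And>m t. m \<le> max (card lam) n \<Longrightarrow>
      infinitesimal_rotation N m p q t = (\<Sum>x\<le>d. w x *\<^sub>C tensor_act N m (g x) t)"
    using infinitesimal_rotation_eq_group_combination[OF pq, of "max (card lam) n"] by blast
  note v' = v[unfolded centralizer_module_def]
  have eq: "infinitesimal_rotation N (card lam) p q \<circ> u = (\<Sum>x\<le>d. w x *\<^sub>C weyl_act N lam (g x) u)"
    using comb[of "card lam"] by (simp add: fun_eq_iff sum_fun_apply scaleC_fun_def weyl_act_def)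
  have mem: "weyl_act N lam (g x) u \<in> weyl_module N lam" for x
    by (rule weyl_act_mem[OF g u])
  note mem' = complex_space.subspace_scale[OF subspace_weyl_module mem]
  show "infinitesimal_rotation N (card lam) p q \<circ> u \<in> weyl_module N lam"
    unfolding eq by (intro complex_space.subspace_sum[OF subspace_weyl_module] mem')
  have "v (infinitesimal_rotation N (card lam) p q \<circ> u) = (\<Sum>x\<le>d. v (w x *\<^sub>C weyl_act N lam (g x) u))"
    unfolding eq by (intro intertwiner_sum[OF v' subspace_weyl_module] mem')
  also have "\<dots> = (\<Sum>x\<le>d. w x *\<^sub>C tensor_act N n (g x) (v u))"
    by (simp add: intertwinersD(4)[OF v' mem] intertwinersD(5)[OF v' g u])
  also have "\<dots> = infinitesimal_rotation N n p q (v u)"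
    using comb[of n] by simp
  finally show "v (infinitesimal_rotation N (card lam) p q \<circ> u) = infinitesimal_rotation N n p q (v u)" .
qed

lemma centralizer_module_mem_tensors:
  assumes "v \<in> centralizer_module N n lam"
  shows "v u \<in> tensors N n"
proof (cases "u \<in> weyl_module N lam")
  case True
  then show ?thesis using intertwinersD(1)[OF assms[unfolded centralizer_module_def]] by blast
qed (simp add: intertwinersD(2)[OF assms[unfolded centralizer_module_def]])

text \<open>By \<open>casimir_eq\<close> on both sides of \<open>v\<close>, which commutes with infinitesimal rotations.\<close>

lemma jucys_murphy_sum_centralizer_module:
  assumes lam: "young_diagram lam" and v: "v \<in> centralizer_module N n lam"
  shows "brauer_act N n (jucys_murphy_sum N n n) v = jucys_murphy_sum_value N lam *\<^sub>C v"
proof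
  fix u
  let ?m = "card lam"
  let ?Z = "brauer_rep N n (jucys_murphy_sum N n n)"
  note v' = v[unfolded centralizer_module_def]
  have "?Z (v u) = jucys_murphy_sum_value N lam *\<^sub>C v u"
  proof (cases "u \<in> weyl_module N lam")
    case u: True
    let ?D = "\<lambda>p q. infinitesimal_rotation N ?m p q \<circ> (infinitesimal_rotation N ?m p q \<circ> u)"
    note D = infinitesimal_rotation_equivariant[OF v]
    have "(\<Sum>p<N. \<Sum>q<N. ?D p q) = (-4 * jucys_murphy_sum_value N lam) *\<^sub>C u"
    proof
      fix f
      have "(\<Sum>p<N. \<Sum>q<N. ?D p q) f =
          (\<Sum>p<N. \<Sum>q<N. infinitesimal_rotation N ?m p q (infinitesimal_rotation N ?m p q (u f)))"
        by (simp add: sum_fun_apply)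
      also have "\<dots> = (-4) *\<^sub>C (jucys_murphy_sum_value N lam *\<^sub>C u f)"
        unfolding casimir_eq[OF weyl_module_mem_tensors[OF u]] jucys_murphy_sum_weyl[OF lam u] ..
      finally show "(\<Sum>p<N. \<Sum>q<N. ?D p q) f = ((-4 * jucys_murphy_sum_value N lam) *\<^sub>C u) f"
        by (simp add: scaleC_scaleC scaleC_fun_def)
    qed
    then have "(-4 * jucys_murphy_sum_value N lam) *\<^sub>C v u = v (\<Sum>p<N. \<Sum>q<N. ?D p q)"
      by (simp only: intertwinersD(4)[OF v' u])
    also have "\<dots> = (\<Sum>p<N. v (\<Sum>q<N. ?D p q))"
      by (intro intertwiner_sum[OF v' subspace_weyl_module] complex_space.subspace_sum[OF subspace_weyl_module])
        (simp add: D u)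
    also have "\<dots> = (\<Sum>p<N. \<Sum>q<N. v (?D p q))"
      by (intro sum.cong refl intertwiner_sum[OF v' subspace_weyl_module]) (simp add: D u)
    also have "\<dots> = (\<Sum>p<N. \<Sum>q<N. infinitesimal_rotation N n p q (infinitesimal_rotation N n p q (v u)))"
      by (intro sum.cong refl) (simp add: D u)
    also have "\<dots> = (-4) *\<^sub>C ?Z (v u)"
      by (rule casimir_eq[OF centralizer_module_mem_tensors[OF v]])
    finally have "(-4) *\<^sub>C ?Z (v u) = (-4) *\<^sub>C (jucys_murphy_sum_value N lam *\<^sub>C v u)"
      by (simp add: scaleC_scaleC)
    then show ?thesis by (rule complex_space.scale_left_imp_eq[rotated]) simp
  next
    case False
    then have "v u = 0" using intertwinersD(2)[OF v'] by blast
    then show ?thesis by (simp add: brauer_rep_0_right)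
  qed
  then show "brauer_act N n (jucys_murphy_sum N n n) v u = (jucys_murphy_sum_value N lam *\<^sub>C v) u"
    by (simp add: brauer_act_def centralizer_act_def scaleC_fun_def)
qed

lemma jucys_murphy_sum_restriction_component:
  assumes mu: "young_diagram \<mu>" and k: "k \<le> n"
    and v: "v \<in> restriction_component N n lam k \<mu>"
  shows "brauer_act N n (jucys_murphy_sum N n k) v = jucys_murphy_sum_value N \<mu> *\<^sub>C v"
proof -
  let ?Z = "brauer_rep N k (jucys_murphy_sum N k k)"
  define S where "S = {v :: centralizer_vector. \<forall>u. v u \<in> tensors N n \<and>
    brauer_rep N n (jucys_murphy_sum N n k) (v u) = jucys_murphy_sum_value N \<mu> *\<^sub>C v u}"
  have S: "complex_space.subspace S"
    by (rule complex_space.subspaceI)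
      (simp_all add: S_def brauer_rep_0_right brauer_rep_add_right brauer_rep_scaleC_right
        scaleC_fun_apply scaleC_add_right scaleC_scaleC mult.commute
        complex_space.subspace_add[OF subspace_tensors] complex_space.subspace_scale[OF subspace_tensors])
  have "f w \<in> S"
    if f: "f \<in> intertwiners (centralizer_algebra N k) centralizer_act (centralizer_module N k \<mu>)
      (\<lambda>c. centralizer_act (centralizer_embed N k n c)) (centralizer_module N n lam)"
    and w: "w \<in> centralizer_module N k \<mu>" for f w
  proof -
    note D = intertwinersD[OF f]
    have mem: "f w u \<in> tensors N n" for u
      using centralizer_module_mem_tensors[OF D(1)[OF w]] .
    have "brauer_act N n (jucys_murphy_sum N n k) (f w) = centralizer_act (centralizer_embed N k n ?Z) (f w)"
      using mem by (simp add: brauer_act_def centralizer_act_def fun_eq_iff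
          centralizer_embed_jucys_murphy_sum[OF k])
    also have "\<dots> = f (brauer_act N k (jucys_murphy_sum N k k) w)"
      using D(5)[OF jucys_murphy_sum_mem_centralizer w] by (simp add: brauer_act_def)
    also have "\<dots> = jucys_murphy_sum_value N \<mu> *\<^sub>C f w"
      unfolding jucys_murphy_sum_centralizer_module[OF mu w] by (rule D(4)[OF w])
    finally show ?thesis
      using mem by (simp add: S_def brauer_act_def centralizer_act_def fun_eq_iff scaleC_fun_apply)
  qed
  then have "restriction_component N n lam k \<mu> \<subseteq> S"
    unfolding restriction_component_def isotypic_component_def
    by (intro complex_space.span_minimal[OF _ S]) blast
  then show ?thesis
    using v by (auto simp: S_def brauer_act_def centralizer_act_def fun_eq_iff scaleC_fun_apply)
qed

lemma jucys_murphy_sum_canonical: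
  assumes path: "\<Lambda> \<in> diagram_paths N n lam" and k: "k \<le> n" "n \<ge> 1"
    and v: "canonical_vector N n lam \<Lambda> v"
  shows "brauer_act N n (jucys_murphy_sum N n k) v = jucys_murphy_sum_value N (\<Lambda> k) *\<^sub>C v"
proof -
  have young: "young_diagram (\<Lambda> k)" if "k \<in> {1..n}"
    using path that by (auto simp: diagram_paths_def orthogonal_diagrams_def)
  consider "k = 0" | "k = n" "k \<in> {1..n}" | "k \<in> {1..<n}" using k by fastforce
  then show ?thesis
  proof cases
    case 1
    have "\<Lambda> 0 = {}" using path by (simp add: diagram_paths_def)
    moreover have "brauer_act N n 0 v = 0"
      using brauer_rep_0[of N n] by (simp only: brauer_act_def centralizer_act_def) (simp add: fun_eq_iff)
    ultimately show ?thesis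
      using 1 by (simp add: jucys_murphy_sum_def jucys_murphy_sum_value_def diagram_content_def)
  next
    case 2
    then show ?thesis
      using jucys_murphy_sum_centralizer_module[OF young] path v
      by (auto simp: diagram_paths_def canonical_vector_def)
  next
    case 3
    then have "v \<in> restriction_component N n lam k (\<Lambda> k)"
      using v unfolding canonical_vector_def by blast
    then show ?thesis
      by (rule jucys_murphy_sum_restriction_component[rotated 2]) (use 3 in \<open>auto intro: young\<close>)
  qed
qed

lemma jucys_murphy_sum_value_insert:
  assumes "young_diagram lam" "(i, j) \<notin> lam"
  shows "jucys_murphy_sum_value N (insert (i, j) lam) =
    jucys_murphy_sum_value N lam + ((of_nat N - 1) / 2 + of_nat j - of_nat i)"
proof -
  have "finite lam" using assms(1) by (simp add: young_diagram_def)
  then show ?thesis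
    using assms(2) by (simp add: jucys_murphy_sum_value_def diagram_content_def add_divide_distrib distrib_right)
qed

theorem theorem2p6:
  fixes n N k i j :: nat
    and lam :: diagram
    and \<Lambda> :: "nat \<Rightarrow> diagram"
    and v :: centralizer_vector
  assumes "n \<ge> 1" and "N \<ge> 1"
    and "lam \<in> orthogonal_diagrams n N"
    and "\<Lambda> \<in> diagram_paths N n lam"
    and "k \<in> {1..n}"
    and "differ_by_box (i, j) (\<Lambda> (k - 1)) (\<Lambda> k)"
    and "canonical_vector N n lam \<Lambda> v"
  shows "(\<Lambda> (k - 1) \<subset> \<Lambda> k \<longrightarrow>
            brauer_act N n (jucys_murphy N n k) v =
              ((of_nat N - 1) / 2 + of_nat j - of_nat i) *\<^sub>C v) \<and>
         (\<Lambda> k \<subset> \<Lambda> (k - 1) \<longrightarrow>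
            brauer_act N n (jucys_murphy N n k) v =
              (- ((of_nat N - 1) / 2 + of_nat j - of_nat i)) *\<^sub>C v)"
proof -
  let ?e = "\<lambda>k. jucys_murphy_sum_value N (\<Lambda> k)"
  note Z = jucys_murphy_sum_canonical[OF assms(4) _ assms(1,7)]
  have le: "k \<le> n" "k - 1 \<le> n" using assms(5) by auto
  have k: "{1..k} = insert k {1..k - 1}" "k \<notin> {1..k - 1}" using assms(5) by auto
  have "jucys_murphy_sum N n k = jucys_murphy N n k + jucys_murphy_sum N n (k - 1)"
    unfolding jucys_murphy_sum_def k(1) by (rule sum.insert) (use k(2) in simp_all)
  then have "jucys_murphy N n k = jucys_murphy_sum N n k - jucys_murphy_sum N n (k - 1)"
    by simp
  then have "brauer_act N n (jucys_murphy N n k) v =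
      brauer_act N n (jucys_murphy_sum N n k) v - brauer_act N n (jucys_murphy_sum N n (k - 1)) v"
    using brauer_rep_diff[of N n "jucys_murphy_sum N n k" "jucys_murphy_sum N n (k - 1)"]
    by (simp only: brauer_act_def centralizer_act_def) (simp add: fun_eq_iff)
  also have "\<dots> = (?e k - ?e (k - 1)) *\<^sub>C v"
    using Z[OF le(1)] Z[OF le(2)] by (simp add: complex_space.scale_left_diff_distrib)
  finally have x: "brauer_act N n (jucys_murphy N n k) v = (?e k - ?e (k - 1)) *\<^sub>C v" .
  have young: "young_diagram (\<Lambda> m)" if "m \<le> n" for m
  proof (cases "m = 0")
    case True
    then show ?thesis using assms(4) by (simp add: diagram_paths_def young_diagram_def)
  next
    case False
    then show ?thesis using assms(4) that by (auto simp: diagram_paths_def orthogonal_diagrams_def)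
  qed
  from assms(6) consider
      "(i, j) \<notin> \<Lambda> (k - 1)" "\<Lambda> k = insert (i, j) (\<Lambda> (k - 1))"
    | "(i, j) \<notin> \<Lambda> k" "\<Lambda> (k - 1) = insert (i, j) (\<Lambda> k)"
    unfolding differ_by_box_def by blast
  then show ?thesis
  proof cases
    case 1
    then have "\<not> \<Lambda> k \<subset> \<Lambda> (k - 1)" by blast
    moreover have "?e k - ?e (k - 1) = (of_nat N - 1) / 2 + of_nat j - of_nat i"
      unfolding 1(2) using jucys_murphy_sum_value_insert[OF young[OF le(2)] 1(1)] by simp
    ultimately show ?thesis using x by simp
  next
    case 2
    then have "\<not> \<Lambda> (k - 1) \<subset> \<Lambda> k" by blast
    moreover have "?e k - ?e (k - 1) = - ((of_nat N - 1) / 2 + of_nat j - of_nat i)"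
      unfolding 2(2) using jucys_murphy_sum_value_insert[OF young[OF le(1)] 2(1)] by simp
    ultimately show ?thesis using x by simp
  qed
qed

end
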